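(* Let $q$ be an odd prime power, $d\ge3$, $Q$ a nondegenerate quadratic form on $\mathbb F_q^d$, and let $v,w,R,X_R,N_R,Z,t,c_z,A_z,\mathcal S_z,P,\mathcal S$ be as in the block construction described in the context. Then the following hold. (1) $|P|=tN_R$ and $|\mathcal S|=tq$. (2) For $b,z\in Z$, $$\sigma(A_b,\mathcal S_z)=\begin{cases}(q-1)N_R,&b=z,\\0,&b\ne z,\end{cases}$$ and consequently $$\sigma(P,\mathcal S)=t(q-1)N_R=\sum_{z\in Z}\sigma(A_z,\mathcal S_z).$$ The exact parameter $K_*$ defined by $\sigma(P,\mathcal S)=K_*q^{(d-1)/2}\sqrt{|P||\mathcal S|}$ is $$K_*=(1-q^{-1})\frac{\sqrt{N_R}}{q^{(d-2)/2}}.$$ Thus $K_*\to1$ as $q\to\infty$ for each fixed $d\ge4$, while for $d=3$ one may choose $R$ so that $K_*=(1-q^{-1})\sqrt2$. (3) Every point $x\in P$ has degree $d_{\mathcal S}(x)=q+t-1$. (4) If $z\in Z$ and $u\ne u'$ in $\mathbb F_q$, then $$S_Q(c_z+uv,R)\cap S_Q(c_z+u'v,R)=A_z.$$ All these pairs have center-difference direction $[v]$ (the center difference is a nonzero multiple of $v$), and their radical hyperplane is $$H_z=\{x\in\mathbb F_q^d:\langle x,v\rangle_Q=z\}.$$ (5) If $d\ge4$ and $H$ is an affine hyperplane, then $$|P\cap H|\le\max\{N_R,\,2tq^{d-3}\}.$$ In particular, for each $d\ge4$ there is a constant $B_d>0$ such that, for all sufficiently large $q$, $$\max_H\frac{|P\cap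 H|}{|P|}\le B_d\max\left\{\frac1t,\frac1q\right\},$$ the maximum being over affine hyperplanes $H\subseteq\mathbb F_q^d$.
   Context: Put $\langle x,y\rangle_Q=\frac{Q(x+y)-Q(x)-Q(y)}2$, $v^{\perp_Q}=\{x:\langle x,v\rangle_Q=0\}$, and $S_Q(c,r)=\{x\in\mathbb F_q^d:Q(x-c)=r\}$; spheres are parametrized by pairs $(c,r)$. $\sigma(A,\mathcal T)=|\{(p,S)\in A\times\mathcal T:p\in S\}|-|A||\mathcal T|/q$ and $d_{\mathcal S}(x)=|\{S\in\mathcal S:x\in S\}|$. For nonconcentric $S=S_Q(c,r)$, $S'=S_Q(c',r')$ the radical hyperplane is $\{x:2\langle c'-c,x\rangle_Q=(r-r')-Q(c)+Q(c')\}$. Block construction. Choose $v\ne0$ with $Q(v)=0$ (possible since $d\ge3$) and $w\in\mathbb F_q^d$ with $\langle w,v\rangle_Q=1$. Choose $R\in\mathbb F_q^\times$ represented by $Q$ on $v^{\perp_Q}$ (equivalently by the nondegenerate form induced by $Q$ on $v^{\perp_Q}/\mathbb F_qv$), and put $$X_R=\{y\in v^{\perp_Q}:Q(y)=R\},\qquad N_R=|X_R|>0.$$ Let $Z\subseteq\mathbb F_q$ be nonempty, $t=|Z|$. For $z\in Z$ put $$c_z=zw,\qquad A_z=c_z+X_R,\qquad\mathcal S_z=\{S_Q(c_z+uv,R):u\in\mathbb F_q\},$$ and $P=\bigsqcup_{z\in Z}A_z$, $\mathcal S=\bigsqcup_{z\in Z}\mathcal S_z$ (these unions are disjoint). *)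

theory Defs
  imports Complex_Main "HOL-Algebra.Algebra"
begin

text \<open>
  Fields are HOL-Algebra structures with explicit carriers, since the asymptotic claims quantify
  over all finite fields inside the formula. The element type stays arbitrary; for \<open>'a = nat\<close>
  every finite field occurs up to isomorphism.
\<close>

definition Vec :: "'a ring \<Rightarrow> nat \<Rightarrow> ('a, nat \<Rightarrow> 'a) module" where
  "Vec F d =
    \<lparr>partial_object.carrier = {..<d} \<rightarrow>\<^sub>E carrier F,
     monoid.mult = (\<lambda>x y. \<lambda>i\<in>{..<d}. x i \<otimes>\<^bsub>F\<^esub> y i),
     monoid.one = (\<lambda>i\<in>{..<d}. \<one>\<^bsub>F\<^esub>),
     ring.zero = (\<lambda>i\<in>{..<d}. \<zero>\<^bsub>F\<^esub>),
     ring.add = (\<lambda>x y. \<lambda>i\<in>{..<d}. x i \<oplus>\<^bsub>F\<^esub> y i),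
     module.smult = (\<lambda>a x. \<lambda>i\<in>{..<d}. a \<otimes>\<^bsub>F\<^esub> x i)\<rparr>"

definition quadratic_form :: "'a ring \<Rightarrow> nat \<Rightarrow> ((nat \<Rightarrow> 'a) \<Rightarrow> 'a) \<Rightarrow> bool" where
  "quadratic_form F d Q \<longleftrightarrow>
    (\<exists>a \<in> {..<d} \<rightarrow> {..<d} \<rightarrow> carrier F. \<forall>x \<in> carrier (Vec F d).
      Q x = (\<Oplus>\<^bsub>F\<^esub>i\<in>{..<d}. \<Oplus>\<^bsub>F\<^esub>j\<in>{..<d}. a i j \<otimes>\<^bsub>F\<^esub> x i \<otimes>\<^bsub>F\<^esub> x j))"

definition two :: "'a ring \<Rightarrow> 'a" where
  "two F = \<one>\<^bsub>F\<^esub> \<oplus>\<^bsub>F\<^esub> \<one>\<^bsub>F\<^esub>"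

definition bform ::
  "'a ring \<Rightarrow> nat \<Rightarrow> ((nat \<Rightarrow> 'a) \<Rightarrow> 'a) \<Rightarrow> (nat \<Rightarrow> 'a) \<Rightarrow> (nat \<Rightarrow> 'a) \<Rightarrow> 'a" where
  "bform F d Q x y =
    (Q (x \<oplus>\<^bsub>Vec F d\<^esub> y) \<ominus>\<^bsub>F\<^esub> Q x \<ominus>\<^bsub>F\<^esub> Q y) \<otimes>\<^bsub>F\<^esub> inv\<^bsub>F\<^esub> (two F)"

definition nondegenerate :: "'a ring \<Rightarrow> nat \<Rightarrow> ((nat \<Rightarrow> 'a) \<Rightarrow> 'a) \<Rightarrow> bool" where
  "nondegenerate F d Q \<longleftrightarrow>
    (\<forall>x \<in> carrier (Vec F d).
      (\<forall>y \<in> carrier (Vec F d). bform F d Q x y = \<zero>\<^bsub>F\<^esub>) \<longrightarrow> x = \<zero>\<^bsub>Vec F d\<^esub>)"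

definition perp :: "'a ring \<Rightarrow> nat \<Rightarrow> ((nat \<Rightarrow> 'a) \<Rightarrow> 'a) \<Rightarrow> (nat \<Rightarrow> 'a) \<Rightarrow> (nat \<Rightarrow> 'a) set" where
  "perp F d Q v = {x \<in> carrier (Vec F d). bform F d Q x v = \<zero>\<^bsub>F\<^esub>}"

text \<open>Spheres are parametrized: a family of spheres is a set of pairs (centre, radius).\<close>

definition sphere_pts ::
  "'a ring \<Rightarrow> nat \<Rightarrow> ((nat \<Rightarrow> 'a) \<Rightarrow> 'a) \<Rightarrow> (nat \<Rightarrow> 'a) \<times> 'a \<Rightarrow> (nat \<Rightarrow> 'a) set" where
  "sphere_pts F d Q S = {x \<in> carrier (Vec F d). Q (x \<ominus>\<^bsub>Vec F d\<^esub> fst S) = snd S}"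

definition sigma_inc ::
  "'a ring \<Rightarrow> nat \<Rightarrow> ((nat \<Rightarrow> 'a) \<Rightarrow> 'a) \<Rightarrow> (nat \<Rightarrow> 'a) set \<Rightarrow> ((nat \<Rightarrow> 'a) \<times> 'a) set \<Rightarrow> real" where
  "sigma_inc F d Q A T =
    real (card {(p, S). p \<in> A \<and> S \<in> T \<and> p \<in> sphere_pts F d Q S})
      - real (card A) * real (card T) / real (order F)"

definition deg_at ::
  "'a ring \<Rightarrow> nat \<Rightarrow> ((nat \<Rightarrow> 'a) \<Rightarrow> 'a) \<Rightarrow> ((nat \<Rightarrow> 'a) \<times> 'a) set \<Rightarrow> (nat \<Rightarrow> 'a) \<Rightarrow> nat" where
  "deg_at F d Q T x = card {S \<in> T. x \<in> sphere_pts F d Q S}"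

definition exact_param ::
  "'a ring \<Rightarrow> nat \<Rightarrow> ((nat \<Rightarrow> 'a) \<Rightarrow> 'a) \<Rightarrow> (nat \<Rightarrow> 'a) set \<Rightarrow> ((nat \<Rightarrow> 'a) \<times> 'a) set \<Rightarrow> real" where
  "exact_param F d Q A T =
    sigma_inc F d Q A T
      / (real (order F) powr ((real d - 1) / 2) * sqrt (real (card A) * real (card T)))"

definition radical_hyperplane ::
  "'a ring \<Rightarrow> nat \<Rightarrow> ((nat \<Rightarrow> 'a) \<Rightarrow> 'a) \<Rightarrow> (nat \<Rightarrow> 'a) \<times> 'a \<Rightarrow> (nat \<Rightarrow> 'a) \<times> 'a
    \<Rightarrow> (nat \<Rightarrow> 'a) set" where
  "radical_hyperplane F d Q S S' =
    {x \<in> carrier (Vec F d).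
      two F \<otimes>\<^bsub>F\<^esub> bform F d Q (fst S' \<ominus>\<^bsub>Vec F d\<^esub> fst S) x
        = (snd S \<ominus>\<^bsub>F\<^esub> snd S') \<ominus>\<^bsub>F\<^esub> Q (fst S) \<oplus>\<^bsub>F\<^esub> Q (fst S')}"

definition affine_hyperplanes :: "'a ring \<Rightarrow> nat \<Rightarrow> (nat \<Rightarrow> 'a) set set" where
  "affine_hyperplanes F d =
    {{x \<in> carrier (Vec F d). (\<Oplus>\<^bsub>F\<^esub>i\<in>{..<d}. a i \<otimes>\<^bsub>F\<^esub> x i) = b} | a b.
      a \<in> carrier (Vec F d) \<and> a \<noteq> \<zero>\<^bsub>Vec F d\<^esub> \<and> b \<in> carrier F}"

text \<open>A finite field of odd order is exactly \<open>F\<^sub>q\<close> for an odd prime power \<open>q\<close>.\<close>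

definition quadratic_space :: "'a ring \<Rightarrow> nat \<Rightarrow> ((nat \<Rightarrow> 'a) \<Rightarrow> 'a) \<Rightarrow> bool" where
  "quadratic_space F d Q \<longleftrightarrow>
    field F \<and> finite (carrier F) \<and> odd (order F) \<and> d \<ge> 3
      \<and> quadratic_form F d Q \<and> nondegenerate F d Q"

definition isotropic_pair ::
  "'a ring \<Rightarrow> nat \<Rightarrow> ((nat \<Rightarrow> 'a) \<Rightarrow> 'a) \<Rightarrow> (nat \<Rightarrow> 'a) \<Rightarrow> (nat \<Rightarrow> 'a) \<Rightarrow> bool" where
  "isotropic_pair F d Q v w \<longleftrightarrow>
    v \<in> carrier (Vec F d) \<and> v \<noteq> \<zero>\<^bsub>Vec F d\<^esub> \<and> Q v = \<zero>\<^bsub>F\<^esub>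
      \<and> w \<in> carrier (Vec F d) \<and> bform F d Q w v = \<one>\<^bsub>F\<^esub>"

definition admissible_radius ::
  "'a ring \<Rightarrow> nat \<Rightarrow> ((nat \<Rightarrow> 'a) \<Rightarrow> 'a) \<Rightarrow> (nat \<Rightarrow> 'a) \<Rightarrow> 'a \<Rightarrow> bool" where
  "admissible_radius F d Q v R \<longleftrightarrow>
    R \<in> carrier F \<and> R \<noteq> \<zero>\<^bsub>F\<^esub> \<and> (\<exists>y \<in> perp F d Q v. Q y = R)"

definition block_data ::
  "'a ring \<Rightarrow> nat \<Rightarrow> ((nat \<Rightarrow> 'a) \<Rightarrow> 'a) \<Rightarrow> (nat \<Rightarrow> 'a) \<Rightarrow> (nat \<Rightarrow> 'a) \<Rightarrow> 'a \<Rightarrow> 'a set \<Rightarrow> bool" where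
  "block_data F d Q v w R Z \<longleftrightarrow>
    quadratic_space F d Q \<and> isotropic_pair F d Q v w \<and> admissible_radius F d Q v R
      \<and> Z \<subseteq> carrier F \<and> Z \<noteq> {}"

definition block_X ::
  "'a ring \<Rightarrow> nat \<Rightarrow> ((nat \<Rightarrow> 'a) \<Rightarrow> 'a) \<Rightarrow> (nat \<Rightarrow> 'a) \<Rightarrow> 'a \<Rightarrow> (nat \<Rightarrow> 'a) set" where
  "block_X F d Q v R = {y \<in> perp F d Q v. Q y = R}"

definition block_center :: "'a ring \<Rightarrow> nat \<Rightarrow> (nat \<Rightarrow> 'a) \<Rightarrow> 'a \<Rightarrow> (nat \<Rightarrow> 'a)" where
  "block_center F d w z = z \<odot>\<^bsub>Vec F d\<^esub> w"

definition block_A ::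
  "'a ring \<Rightarrow> nat \<Rightarrow> ((nat \<Rightarrow> 'a) \<Rightarrow> 'a) \<Rightarrow> (nat \<Rightarrow> 'a) \<Rightarrow> (nat \<Rightarrow> 'a) \<Rightarrow> 'a \<Rightarrow> 'a
    \<Rightarrow> (nat \<Rightarrow> 'a) set" where
  "block_A F d Q v w R z =
    (\<lambda>y. block_center F d w z \<oplus>\<^bsub>Vec F d\<^esub> y) ` block_X F d Q v R"

definition block_sphere ::
  "'a ring \<Rightarrow> nat \<Rightarrow> (nat \<Rightarrow> 'a) \<Rightarrow> (nat \<Rightarrow> 'a) \<Rightarrow> 'a \<Rightarrow> 'a \<Rightarrow> 'a \<Rightarrow> (nat \<Rightarrow> 'a) \<times> 'a" where
  "block_sphere F d v w R z u =
    (block_center F d w z \<oplus>\<^bsub>Vec F d\<^esub> (u \<odot>\<^bsub>Vec F d\<^esub> v), R)"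

definition block_S ::
  "'a ring \<Rightarrow> nat \<Rightarrow> (nat \<Rightarrow> 'a) \<Rightarrow> (nat \<Rightarrow> 'a) \<Rightarrow> 'a \<Rightarrow> 'a \<Rightarrow> ((nat \<Rightarrow> 'a) \<times> 'a) set" where
  "block_S F d v w R z = block_sphere F d v w R z ` carrier F"

definition all_P ::
  "'a ring \<Rightarrow> nat \<Rightarrow> ((nat \<Rightarrow> 'a) \<Rightarrow> 'a) \<Rightarrow> (nat \<Rightarrow> 'a) \<Rightarrow> (nat \<Rightarrow> 'a) \<Rightarrow> 'a \<Rightarrow> 'a set
    \<Rightarrow> (nat \<Rightarrow> 'a) set" where
  "all_P F d Q v w R Z = (\<Union>z\<in>Z. block_A F d Q v w R z)"

definition all_S ::
  "'a ring \<Rightarrow> nat \<Rightarrow> (nat \<Rightarrow> 'a) \<Rightarrow> (nat \<Rightarrow> 'a) \<Rightarrow> 'a \<Rightarrow> 'a set \<Rightarrow> ((nat \<Rightarrow> 'a) \<times> 'a) set" where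
  "all_S F d v w R Z = (\<Union>z\<in>Z. block_S F d v w R z)"

definition K_star ::
  "'a ring \<Rightarrow> nat \<Rightarrow> ((nat \<Rightarrow> 'a) \<Rightarrow> 'a) \<Rightarrow> (nat \<Rightarrow> 'a) \<Rightarrow> (nat \<Rightarrow> 'a) \<Rightarrow> 'a \<Rightarrow> 'a set \<Rightarrow> real" where
  "K_star F d Q v w R Z = exact_param F d Q (all_P F d Q v w R Z) (all_S F d v w R Z)"

end

theory Submission
  imports Defs "HOL-Real_Asymp.Real_Asymp"
begin

text \<open>
  Put \<open>V = v\<^sup>\<bottom>\<close>. Because \<open>Q v = 0\<close>, the map \<open>u \<mapsto> Q (x - z w - u v)\<close> is affine with slope
  \<open>2 (z - \<langle>x, v\<rangle>)\<close>: it is constant on the block at height \<open>z\<close>, and it takes every value exactly once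
  on the other blocks. This gives all exact incidence counts.

  The size \<open>N r\<close> of the level \<open>{y \<in> V. Q y = r}\<close> is estimated by a second moment instead of a
  diagonalization. Factoring \<open>Q x - Q y = \<langle>x - y, x + y\<rangle>\<close> bounds \<open>\<Sum>r. (N r)\<^sup>2\<close> by the number of orthogonal
  pairs in \<open>V\<close>, which is explicit since the radical of \<open>V\<close> is the line of \<open>v\<close>. The resulting variance
  is shared by the \<open>(q - 1) / 2\<close> elements of a square class, on which \<open>N\<close> is constant, so that
  \<open>(N r - q ^ (d - 2))\<^sup>2 \<le> 2 q ^ (d - 1)\<close> for \<open>r \<noteq> 0\<close>.
\<close>

text \<open>An exact level count would need the quadratic character of the form induced on
  \<open>V\<close> modulo the line of \<open>v\<close>. The cruder deviation is enough because the
  square of its relative error is at most \<open>2 / q ^ (d - 3)\<close>, which tends to 0 as soon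
  as \<open>d \<ge> 4\<close>. For \<open>d = 3\<close> this says nothing, and the plane
  \<open>V\<close> is parametrized directly: a nonempty level at a nonzero value then has
  \<open>2 q\<close> points, twice the average, and this is the source of \<open>sqrt 2\<close>.

  The value 0 has to be excluded from the deviation bound, since its square class is a single
  element that could carry the whole variance.

  All sizes of subspaces come from one double count along parallel lines on which a function is
  affine. So neither bases nor a dimension theory are needed: the geometry takes place in an
  abstract module of known cardinality, and coordinates serve only to produce an instance of
  it.\<close>

lemma card_le_2I:
  assumes "\<And>x y z. \<lbrakk>x \<in> A; y \<in> A; z \<in> A; x \<noteq> y; x \<noteq> z; y \<noteq> z\<rbrakk> \<Longrightarrow> False"
  shows "card A \<le> 2"
proof (rule ccontr)
  assume "\<not> card A \<le> 2"
  then obtain T where "T \<subseteq> A" "card T = 3"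
    using obtain_subset_with_card_n[of 3 A] by auto
  then show False using assms unfolding card_3_iff by blast
qed

section \<open>Characteristic and low-degree equations in a finite field of odd order\<close>

context field
begin

lemma order_gt_1:
  assumes "finite (carrier R)"
  shows "order R > 1"
proof -
  have "card {\<zero>, \<one>} \<le> card (carrier R)" using assms by (intro card_mono) auto
  then show ?thesis by (simp add: order_def)
qed

text \<open>Lagrange in the additive group: the multiple of \<open>x\<close> by the odd number
  \<open>order R\<close> vanishes, so \<open>x \<oplus> x = \<zero>\<close> would leave
  \<open>x = \<zero>\<close>.\<close>

lemma double_nonzero:
  assumes "finite (carrier R)" "odd (order R)" "x \<in> carrier R" "x \<noteq> \<zero>"
  shows "x \<oplus> x \<noteq> \<zero>"
proof
  assume dbl: "x \<oplus> x = \<zero>"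
  have "x [^]\<^bsub>add_monoid R\<^esub> order (add_monoid R) = \<zero>"
    using group.pow_order_eq_1[OF add.is_group, of x] assms(3) by simp
  moreover have "order (add_monoid R) = order R" by (simp add: order_def)
  moreover obtain k where "order R = 2 * k + 1" using assms(2) by (elim oddE)
  moreover have "x [^]\<^bsub>add_monoid R\<^esub> (2 * k) = \<zero>" for k :: nat
  proof -
    have "x [^]\<^bsub>add_monoid R\<^esub> (2::nat) = \<zero>"
      using dbl assms(3) by (simp add: numeral_2_eq_2)
    then show ?thesis
      using monoid.nat_pow_pow[OF group.is_monoid[OF add.is_group], of x 2 k] assms(3)
        monoid.nat_pow_one[OF group.is_monoid[OF add.is_group]] by simp
  qed
  ultimately show False using assms(3,4) by simp
qed

lemma affine_equation_solution:
  assumes a: "a \<in> carrier R" "a \<noteq> \<zero>" and k: "k \<in> carrier R" and c: "c \<in> carrier R"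
    and s: "s \<in> carrier R"
  shows "k \<oplus> s \<otimes> a = c \<longleftrightarrow> s = (c \<ominus> k) \<otimes> inv a"
proof -
  have ia: "inv a \<in> carrier R" "a \<otimes> inv a = \<one>" using a field_Units by auto
  show ?thesis
  proof
    assume h: "k \<oplus> s \<otimes> a = c"
    have "(c \<ominus> k) \<otimes> inv a = s \<otimes> (a \<otimes> inv a)"
      unfolding h[symmetric] using k s a(1) ia(1) by algebra
    then show "s = (c \<ominus> k) \<otimes> inv a" using ia s by simp
  next
    assume h: "s = (c \<ominus> k) \<otimes> inv a"
    have "k \<oplus> s \<otimes> a = k \<oplus> (c \<ominus> k) \<otimes> (a \<otimes> inv a)"
      unfolding h using k c a(1) ia(1) by algebra
    also have "\<dots> = c" unfolding ia(2) using k c by algebra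
    finally show "k \<oplus> s \<otimes> a = c" .
  qed
qed

text \<open>Subtracting the equations at two distinct roots and cancelling their difference leaves a
  linear relation. Two such relations sharing a root, subtracted in turn, force
  \<open>a = \<zero>\<close> and then \<open>b = \<zero>\<close>. The degenerate case of a linear
  equation is thus covered as well.\<close>

lemma card_quadratic_roots_le:
  assumes "a \<in> carrier R" "b \<in> carrier R" "k \<in> carrier R" "c \<in> carrier R"
    and "a \<noteq> \<zero> \<or> b \<noteq> \<zero>"
  shows "card {s \<in> carrier R. k \<oplus> s \<otimes> b \<oplus> s \<otimes> s \<otimes> a = c} \<le> 2"
proof (rule card_le_2I)
  have diff: "b \<oplus> (x \<oplus> y) \<otimes> a = \<zero>"
    if "x \<in> carrier R" "y \<in> carrier R" "x \<noteq> y"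
      and "k \<oplus> x \<otimes> b \<oplus> x \<otimes> x \<otimes> a = k \<oplus> y \<otimes> b \<oplus> y \<otimes> y \<otimes> a" for x y
  proof -
    have "(x \<ominus> y) \<otimes> (b \<oplus> (x \<oplus> y) \<otimes> a)
        = (k \<oplus> x \<otimes> b \<oplus> x \<otimes> x \<otimes> a) \<ominus> (k \<oplus> y \<otimes> b \<oplus> y \<otimes> y \<otimes> a)"
      using assms(1-3) that(1,2) by algebra
    also have "\<dots> = \<zero>" using that assms by simp
    finally have "(x \<ominus> y) \<otimes> (b \<oplus> (x \<oplus> y) \<otimes> a) = \<zero>" .
    moreover have "x \<ominus> y \<noteq> \<zero>" using that by simp
    moreover have "x \<ominus> y \<in> carrier R" "b \<oplus> (x \<oplus> y) \<otimes> a \<in> carrier R"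
      using that assms by simp_all
    ultimately show ?thesis using integral by blast
  qed
  fix x y z
  assume A: "x \<in> {s \<in> carrier R. k \<oplus> s \<otimes> b \<oplus> s \<otimes> s \<otimes> a = c}"
    "y \<in> {s \<in> carrier R. k \<oplus> s \<otimes> b \<oplus> s \<otimes> s \<otimes> a = c}"
    "z \<in> {s \<in> carrier R. k \<oplus> s \<otimes> b \<oplus> s \<otimes> s \<otimes> a = c}"
    "x \<noteq> y" "x \<noteq> z" "y \<noteq> z"
  have xy: "b \<oplus> (x \<oplus> y) \<otimes> a = \<zero>" and xz: "b \<oplus> (x \<oplus> z) \<otimes> a = \<zero>"
    using A diff by simp_all
  have "(y \<ominus> z) \<otimes> a = (b \<oplus> (x \<oplus> y) \<otimes> a) \<ominus> (b \<oplus> (x \<oplus> z) \<otimes> a)"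
    using assms(1,2) A by (simp, algebra)
  then have "(y \<ominus> z) \<otimes> a = \<zero>" using xy xz by simp
  moreover have "y \<ominus> z \<noteq> \<zero>" using A by simp
  moreover have "y \<ominus> z \<in> carrier R" using A by simp
  ultimately have "a = \<zero>" using assms(1) integral by blast
  then show False using xy assms A by simp
qed

end

section \<open>Finite quadratic spaces\<close>

text \<open>\<open>Q_add\<close> is polarization without division by two. The number
  \<open>d\<close> enters only through the cardinality \<open>card_M\<close>.\<close>

locale finite_quadratic_space = R?: field R + module R M
  for R :: "('a, 'c) ring_scheme" (structure) and M :: "('a, 'b, 'e) module_scheme" (structure) +
  fixes d :: nat and Q :: "'b \<Rightarrow> 'a" and B :: "'b \<Rightarrow> 'b \<Rightarrow> 'a"
  assumes finite_R: "finite (carrier R)" and odd_order: "odd (order R)"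
    and card_M: "card (carrier M) = order R ^ d"
    and B_closed [simp, intro]: "\<lbrakk>x \<in> carrier M; y \<in> carrier M\<rbrakk> \<Longrightarrow> B x y \<in> carrier R"
    and B_commute: "\<lbrakk>x \<in> carrier M; y \<in> carrier M\<rbrakk> \<Longrightarrow> B x y = B y x"
    and B_add_left: "\<lbrakk>x \<in> carrier M; y \<in> carrier M; z \<in> carrier M\<rbrakk>
      \<Longrightarrow> B (x \<oplus>\<^bsub>M\<^esub> y) z = B x z \<oplus> B y z"
    and B_smult_left: "\<lbrakk>s \<in> carrier R; x \<in> carrier M; y \<in> carrier M\<rbrakk>
      \<Longrightarrow> B (s \<odot>\<^bsub>M\<^esub> x) y = s \<otimes> B x y"
    and Q_closed [simp, intro]: "x \<in> carrier M \<Longrightarrow> Q x \<in> carrier R"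
    and Q_add: "\<lbrakk>x \<in> carrier M; y \<in> carrier M\<rbrakk>
      \<Longrightarrow> Q (x \<oplus>\<^bsub>M\<^esub> y) = Q x \<oplus> Q y \<oplus> (B x y \<oplus> B x y)"
    and Q_smult: "\<lbrakk>s \<in> carrier R; x \<in> carrier M\<rbrakk> \<Longrightarrow> Q (s \<odot>\<^bsub>M\<^esub> x) = s \<otimes> s \<otimes> Q x"
    and nondeg: "\<lbrakk>x \<in> carrier M; \<And>y. y \<in> carrier M \<Longrightarrow> B x y = \<zero>\<rbrakk> \<Longrightarrow> x = \<zero>\<^bsub>M\<^esub>"
begin

lemma order_gt_1: "order R > 1"
  using field.order_gt_1[OF field_axioms finite_R] .

lemma finite_M: "finite (carrier M)"
  using card_M order_gt_1 by (intro card_ge_0_finite) simp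

lemma double_nonzero: "\<lbrakk>x \<in> carrier R; x \<noteq> \<zero>\<rbrakk> \<Longrightarrow> x \<oplus> x \<noteq> \<zero>"
  using field.double_nonzero[OF field_axioms finite_R odd_order] .

lemma B_add_right: "\<lbrakk>x \<in> carrier M; y \<in> carrier M; z \<in> carrier M\<rbrakk>
      \<Longrightarrow> B z (x \<oplus>\<^bsub>M\<^esub> y) = B z x \<oplus> B z y"
  by (metis B_add_left B_commute M.add.m_closed)

lemma B_smult_right: "\<lbrakk>s \<in> carrier R; x \<in> carrier M; y \<in> carrier M\<rbrakk>
      \<Longrightarrow> B y (s \<odot>\<^bsub>M\<^esub> x) = s \<otimes> B y x"
  by (metis B_smult_left B_commute smult_closed)

lemma minus_eq_smult: "x \<in> carrier M \<Longrightarrow> \<ominus>\<^bsub>M\<^esub> x = (\<ominus> \<one>) \<odot>\<^bsub>M\<^esub> x"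
  by (simp add: smult_l_minus)

lemma B_uminus_left: "\<lbrakk>x \<in> carrier M; y \<in> carrier M\<rbrakk> \<Longrightarrow> B (\<ominus>\<^bsub>M\<^esub> x) y = \<ominus> B x y"
  using B_smult_left[of "\<ominus> \<one>" x y] by (simp add: minus_eq_smult l_minus)

lemma B_uminus_right: "\<lbrakk>x \<in> carrier M; y \<in> carrier M\<rbrakk> \<Longrightarrow> B y (\<ominus>\<^bsub>M\<^esub> x) = \<ominus> B y x"
  by (metis B_uminus_left B_commute M.a_inv_closed)

lemma B_diff_left: "\<lbrakk>x \<in> carrier M; y \<in> carrier M; z \<in> carrier M\<rbrakk>
      \<Longrightarrow> B (x \<ominus>\<^bsub>M\<^esub> y) z = B x z \<ominus> B y z"
  by (simp add: a_minus_def B_add_left B_uminus_left)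

lemma B_diff_right: "\<lbrakk>x \<in> carrier M; y \<in> carrier M; z \<in> carrier M\<rbrakk>
      \<Longrightarrow> B z (x \<ominus>\<^bsub>M\<^esub> y) = B z x \<ominus> B z y"
  by (simp add: a_minus_def B_add_right B_uminus_right)

lemma Q_zero: "Q \<zero>\<^bsub>M\<^esub> = \<zero>"
  using Q_smult[of \<zero> "\<zero>\<^bsub>M\<^esub>"] by simp

lemma Q_uminus: "x \<in> carrier M \<Longrightarrow> Q (\<ominus>\<^bsub>M\<^esub> x) = Q x"
  using Q_smult[of "\<ominus> \<one>" x] by (simp add: minus_eq_smult l_minus)

lemma Q_diff: "\<lbrakk>x \<in> carrier M; y \<in> carrier M\<rbrakk>
      \<Longrightarrow> Q (x \<ominus>\<^bsub>M\<^esub> y) = Q x \<oplus> Q y \<ominus> (B x y \<oplus> B x y)"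
  by (simp add: a_minus_def Q_add B_uminus_right Q_uminus minus_add R.minus_add)

lemmas form_simps = B_add_left B_add_right B_smult_left B_smult_right B_uminus_left B_uminus_right
  B_diff_left B_diff_right Q_add Q_diff Q_smult

text \<open>Expanding \<open>Q\<close> at \<open>x - x\<close> shows that twice the difference of
  the two sides is zero.\<close>

lemma B_self: "x \<in> carrier M \<Longrightarrow> B x x = Q x"
proof -
  assume x: "x \<in> carrier M"
  have "Q (x \<ominus>\<^bsub>M\<^esub> x) = \<zero>" using x by (simp add: Q_zero M.r_neg a_minus_def)
  then have "(Q x \<ominus> B x x) \<oplus> (Q x \<ominus> B x x) = \<zero>"
  proof -
    have "(Q x \<ominus> B x x) \<oplus> (Q x \<ominus> B x x) = Q x \<oplus> Q x \<ominus> (B x x \<oplus> B x x)"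
      using Q_closed[OF x] B_closed[OF x x] by algebra
    with \<open>Q (x \<ominus>\<^bsub>M\<^esub> x) = \<zero>\<close> x show ?thesis by (simp add: Q_diff)
  qed
  then have "Q x \<ominus> B x x = \<zero>" using double_nonzero[of "Q x \<ominus> B x x"] x by auto
  then show ?thesis using x by simp
qed

lemma Q_line: "\<lbrakk>x \<in> carrier M; e \<in> carrier M; s \<in> carrier R\<rbrakk>
  \<Longrightarrow> Q (x \<oplus>\<^bsub>M\<^esub> s \<odot>\<^bsub>M\<^esub> e) = Q x \<oplus> s \<otimes> (B x e \<oplus> B x e) \<oplus> s \<otimes> s \<otimes> Q e"
  by (simp add: form_simps R.r_distr R.a_ac)

text \<open>Along the line the equation is polynomial of degree at most two in \<open>s\<close>; the
  last hypothesis says that the polynomial is not constant.\<close>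

lemma card_sphere_line_le:
  assumes "x \<in> carrier M" "e \<in> carrier M" "c \<in> carrier R" "Q e \<noteq> \<zero> \<or> B x e \<noteq> \<zero>"
  shows "card {s \<in> carrier R. Q (x \<oplus>\<^bsub>M\<^esub> s \<odot>\<^bsub>M\<^esub> e) = c} \<le> 2"
proof -
  have "{s \<in> carrier R. Q (x \<oplus>\<^bsub>M\<^esub> s \<odot>\<^bsub>M\<^esub> e) = c}
      = {s \<in> carrier R. Q x \<oplus> s \<otimes> (B x e \<oplus> B x e) \<oplus> s \<otimes> s \<otimes> Q e = c}"
    using assms by (auto simp: Q_line)
  then show ?thesis
    using card_quadratic_roots_le[of "Q e" "B x e \<oplus> B x e" "Q x" c] assms double_nonzero[of "B x e"]
    by auto
qed

text \<open>Both sides count the pairs \<open>(y, s)\<close> with \<open>y + s e \<in> T\<close>.\<close>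

lemma order_mult_card_eq:
  assumes e: "e \<in> carrier M" and G: "G \<subseteq> carrier M"
    and shift: "\<And>y s. \<lbrakk>y \<in> G; s \<in> carrier R\<rbrakk> \<Longrightarrow> y \<oplus>\<^bsub>M\<^esub> s \<odot>\<^bsub>M\<^esub> e \<in> G"
    and T: "T \<subseteq> G"
  shows "order R * card T = (\<Sum>y\<in>G. card {s \<in> carrier R. y \<oplus>\<^bsub>M\<^esub> s \<odot>\<^bsub>M\<^esub> e \<in> T})"
proof -
  have fG: "finite G" using G finite_M finite_subset by blast
  have "(\<Sum>y\<in>G. card {s \<in> carrier R. y \<oplus>\<^bsub>M\<^esub> s \<odot>\<^bsub>M\<^esub> e \<in> T})
      = (\<Sum>y\<in>G. \<Sum>s\<in>carrier R. if y \<oplus>\<^bsub>M\<^esub> s \<odot>\<^bsub>M\<^esub> e \<in> T then 1 else 0)"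
    using finite_R by (simp add: sum.If_cases Int_def)
  also have "\<dots> = (\<Sum>s\<in>carrier R. \<Sum>y\<in>G. if y \<oplus>\<^bsub>M\<^esub> s \<odot>\<^bsub>M\<^esub> e \<in> T then 1 else 0)"
    by (rule sum.swap)
  also have "\<dots> = (\<Sum>s\<in>carrier R. card {y \<in> G. y \<oplus>\<^bsub>M\<^esub> s \<odot>\<^bsub>M\<^esub> e \<in> T})"
    using fG by (simp add: sum.If_cases Int_def)
  also have "\<dots> = (\<Sum>s\<in>carrier R. card T)"
  proof (rule sum.cong[OF refl])
    fix s assume s: "s \<in> carrier R"
    have "bij_betw (\<lambda>y. y \<oplus>\<^bsub>M\<^esub> s \<odot>\<^bsub>M\<^esub> e) {y \<in> G. y \<oplus>\<^bsub>M\<^esub> s \<odot>\<^bsub>M\<^esub> e \<in> T} T"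
    proof (rule bij_betw_byWitness[where f' = "\<lambda>y. y \<oplus>\<^bsub>M\<^esub> (\<ominus> s) \<odot>\<^bsub>M\<^esub> e"])
      have inv: "y \<oplus>\<^bsub>M\<^esub> s \<odot>\<^bsub>M\<^esub> e \<oplus>\<^bsub>M\<^esub> (\<ominus> s) \<odot>\<^bsub>M\<^esub> e = y"
        "y \<oplus>\<^bsub>M\<^esub> (\<ominus> s) \<odot>\<^bsub>M\<^esub> e \<oplus>\<^bsub>M\<^esub> s \<odot>\<^bsub>M\<^esub> e = y" if "y \<in> carrier M" for y
        using that e s by (simp_all add: smult_l_minus M.a_assoc M.r_neg M.l_neg)
      show "\<forall>y\<in>{y \<in> G. y \<oplus>\<^bsub>M\<^esub> s \<odot>\<^bsub>M\<^esub> e \<in> T}.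
          y \<oplus>\<^bsub>M\<^esub> s \<odot>\<^bsub>M\<^esub> e \<oplus>\<^bsub>M\<^esub> (\<ominus> s) \<odot>\<^bsub>M\<^esub> e = y"
        and "\<forall>y\<in>T. y \<oplus>\<^bsub>M\<^esub> (\<ominus> s) \<odot>\<^bsub>M\<^esub> e \<oplus>\<^bsub>M\<^esub> s \<odot>\<^bsub>M\<^esub> e = y"
        using inv G T by blast+
      show "(\<lambda>y. y \<oplus>\<^bsub>M\<^esub> (\<ominus> s) \<odot>\<^bsub>M\<^esub> e) ` T \<subseteq> {y \<in> G. y \<oplus>\<^bsub>M\<^esub> s \<odot>\<^bsub>M\<^esub> e \<in> T}"
        using inv(2) G T shift[of _ "\<ominus> s"] s by (auto simp: subset_iff)
    qed auto
    then show "card {y \<in> G. y \<oplus>\<^bsub>M\<^esub> s \<odot>\<^bsub>M\<^esub> e \<in> T} = card T" by (rule bij_betw_same_card)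
  qed
  finally show ?thesis by (simp add: order_def)
qed

text \<open>Takes the place of rank-nullity: on each line in direction \<open>e\<close> the function
  \<open>f\<close> is affine with nonzero slope \<open>a\<close>, so it attains \<open>c\<close>
  exactly once there, and every summand of the double count is 1.\<close>

lemma order_mult_card_fibre:
  assumes e: "e \<in> carrier M" and G: "G \<subseteq> carrier M"
    and shift: "\<And>y s. \<lbrakk>y \<in> G; s \<in> carrier R\<rbrakk> \<Longrightarrow> y \<oplus>\<^bsub>M\<^esub> s \<odot>\<^bsub>M\<^esub> e \<in> G"
    and f: "\<And>y s. \<lbrakk>y \<in> G; s \<in> carrier R\<rbrakk> \<Longrightarrow> f (y \<oplus>\<^bsub>M\<^esub> s \<odot>\<^bsub>M\<^esub> e) = f y \<oplus> s \<otimes> a"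
    and f_closed: "\<And>y. y \<in> G \<Longrightarrow> f y \<in> carrier R"
    and a: "a \<in> carrier R" "a \<noteq> \<zero>" and c: "c \<in> carrier R"
  shows "order R * card {y \<in> G. f y = c} = card G"
proof -
  have "{s \<in> carrier R. y \<oplus>\<^bsub>M\<^esub> s \<odot>\<^bsub>M\<^esub> e \<in> {y \<in> G. f y = c}} = {(c \<ominus> f y) \<otimes> inv a}"
    if y: "y \<in> G" for y
  proof -
    have ia: "inv a \<in> carrier R" using a field_Units by auto
    have "f y \<oplus> s \<otimes> a = c \<longleftrightarrow> s = (c \<ominus> f y) \<otimes> inv a" if s: "s \<in> carrier R" for s
      using affine_equation_solution[OF a f_closed[OF y] c s] .
    then have "{s \<in> carrier R. y \<oplus>\<^bsub>M\<^esub> s \<odot>\<^bsub>M\<^esub> e \<in> {y \<in> G. f y = c}}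
        = {s \<in> carrier R. s = (c \<ominus> f y) \<otimes> inv a}"
      using y shift f by (intro Collect_cong conj_cong[OF refl]) simp
    also have "\<dots> = {(c \<ominus> f y) \<otimes> inv a}" using ia c f_closed[OF y] by auto
    finally show ?thesis .
  qed
  then have "(\<Sum>y\<in>G. card {s \<in> carrier R. y \<oplus>\<^bsub>M\<^esub> s \<odot>\<^bsub>M\<^esub> e \<in> {y \<in> G. f y = c}}) = card G"
    by simp
  then show ?thesis using order_mult_card_eq[OF e G shift, of "{y \<in> G. f y = c}"] by simp
qed

end

section \<open>The orthogonal hyperplane of an isotropic vector\<close>

locale isotropic_frame = finite_quadratic_space +
  fixes v w
  assumes dim_ge_3: "d \<ge> 3"
    and v_closed [simp, intro]: "v \<in> carrier M" and w_closed [simp, intro]: "w \<in> carrier M"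
    and Q_v: "Q v = \<zero>" and B_w_v: "B w v = \<one>"
begin

definition V :: "'c set" where "V = {x \<in> carrier M. B x v = \<zero>}"

definition level :: "'a \<Rightarrow> 'c set" where "level r = {y \<in> V. Q y = r}"

text \<open>Exponents are truncated differences, so each factor \<open>x\<close> is split off once
  and for all here. The form \<open>d - Suc 0\<close> is the one into which the simplifier brings
  \<open>d - 1\<close>.\<close>

lemma power_dim:
  fixes x :: "'z :: monoid_mult"
  shows "x ^ d = x * x ^ (d - Suc 0)" "x ^ (d - Suc 0) = x * x ^ (d - 2)" "x ^ (d - 2) = x * x ^ (d - 3)"
proof -
  obtain k where "d = Suc (Suc (Suc k))"
    using dim_ge_3 by (auto simp: le_iff_add numeral_3_eq_3)
  then show "x ^ d = x * x ^ (d - Suc 0)" "x ^ (d - Suc 0) = x * x ^ (d - 2)" "x ^ (d - 2) = x * x ^ (d - 3)"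
    by (simp_all add: numeral_2_eq_2 numeral_3_eq_3)
qed

lemma V_subset: "V \<subseteq> carrier M"
  by (auto simp: V_def)

lemma V_closed: "y \<in> V \<Longrightarrow> y \<in> carrier M"
  by (simp add: V_def)

lemma finite_V: "finite V"
  using V_subset finite_M finite_subset by blast

lemma B_v_w: "B v w = \<one>"
  using B_w_v B_commute[OF v_closed w_closed] by simp

lemma v_in_V: "v \<in> V"
  by (simp add: V_def B_self Q_v)

lemma B_V_v: "y \<in> V \<Longrightarrow> B y v = \<zero>" "y \<in> V \<Longrightarrow> B v y = \<zero>"
  using B_commute[of v y] by (auto simp: V_def)

lemma V_add: "\<lbrakk>x \<in> V; y \<in> V\<rbrakk> \<Longrightarrow> x \<oplus>\<^bsub>M\<^esub> y \<in> V"
  by (auto simp: V_def B_add_left)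

lemma V_smult: "\<lbrakk>s \<in> carrier R; y \<in> V\<rbrakk> \<Longrightarrow> s \<odot>\<^bsub>M\<^esub> y \<in> V"
  by (auto simp: V_def B_smult_left)

lemma V_diff: "\<lbrakk>x \<in> V; y \<in> V\<rbrakk> \<Longrightarrow> x \<ominus>\<^bsub>M\<^esub> y \<in> V"
  by (auto simp: V_def B_diff_left)

lemma card_V: "card V = order R ^ (d - 1)"
proof -
  have "order R * card {y \<in> carrier M. B y v = \<zero>} = card (carrier M)"
    by (rule order_mult_card_fibre[where e = w and a = \<one>]) (auto simp: form_simps B_w_v)
  then have "order R * card V = order R * order R ^ (d - 1)"
    by (simp add: V_def card_M power_dim(1))
  then show ?thesis using order_gt_1 by simp
qed

declare V_closed [simp]

text \<open>Every vector differs from an element of \<open>V\<close> by a multiple of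
  \<open>w\<close>. Hence a vector orthogonal to \<open>V\<close> is determined by its pairing with
  \<open>w\<close>, and subtracting \<open>B a w\<close> times \<open>v\<close> makes that pairing
  vanish too; nondegeneracy finishes.\<close>

lemma radical_V:
  assumes a: "a \<in> V" and ort: "\<And>b. b \<in> V \<Longrightarrow> B a b = \<zero>"
  shows "a = B a w \<odot>\<^bsub>M\<^esub> v"
proof -
  have am: "a \<in> carrier M" using a by simp
  have "a \<ominus>\<^bsub>M\<^esub> B a w \<odot>\<^bsub>M\<^esub> v = \<zero>\<^bsub>M\<^esub>"
  proof (rule nondeg)
    show "a \<ominus>\<^bsub>M\<^esub> B a w \<odot>\<^bsub>M\<^esub> v \<in> carrier M" using am by simp
    fix y assume y: "y \<in> carrier M"
    have "y \<ominus>\<^bsub>M\<^esub> B y v \<odot>\<^bsub>M\<^esub> w \<in> V" using y by (simp add: V_def form_simps B_w_v del: V_closed)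
    then have "B a (y \<ominus>\<^bsub>M\<^esub> B y v \<odot>\<^bsub>M\<^esub> w) = \<zero>" by (rule ort)
    then have "B a y = B y v \<otimes> B a w" using am y by (simp add: form_simps)
    then show "B (a \<ominus>\<^bsub>M\<^esub> B a w \<odot>\<^bsub>M\<^esub> v) y = \<zero>"
      using am y B_commute[of v y] R.m_comm[of "B y v" "B a w"] by (simp add: form_simps)
  qed
  then have "a \<ominus>\<^bsub>M\<^esub> B a w \<odot>\<^bsub>M\<^esub> v \<oplus>\<^bsub>M\<^esub> B a w \<odot>\<^bsub>M\<^esub> v = B a w \<odot>\<^bsub>M\<^esub> v"
    using am by simp
  then show ?thesis using am by (simp add: a_minus_def M.a_assoc M.l_neg)
qed

section \<open>Second moment of the level sizes\<close>

definition rad :: "'c set" where "rad = {a \<in> V. \<forall>b\<in>V. B a b = \<zero>}"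

lemma card_rad_le: "card rad \<le> order R"
proof -
  have "rad \<subseteq> (\<lambda>s. s \<odot>\<^bsub>M\<^esub> v) ` carrier R"
  proof
    fix a assume "a \<in> rad"
    then have "a = B a w \<odot>\<^bsub>M\<^esub> v" "B a w \<in> carrier R" using radical_V by (auto simp: rad_def)
    then show "a \<in> (\<lambda>s. s \<odot>\<^bsub>M\<^esub> v) ` carrier R" by blast
  qed
  then show ?thesis
    unfolding order_def using finite_R surj_card_le by blast
qed

text \<open>Outside the radical, pairing with \<open>a\<close> is a nonzero functional on
  \<open>V\<close>, so its kernel is a fibre of proportion \<open>1 / order R\<close>.\<close>

lemma card_orthogonal_V:
  assumes a: "a \<in> V" "a \<notin> rad"
  shows "card {b \<in> V. B a b = \<zero>} = order R ^ (d - 2)"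
proof -
  from a obtain e where e: "e \<in> V" "B a e \<noteq> \<zero>" by (auto simp: rad_def)
  have "order R * card {b \<in> V. B a b = \<zero>} = card V"
    by (rule order_mult_card_fibre[where e = e and a = "B a e"])
      (use a e in \<open>auto simp: form_simps V_add V_smult V_subset\<close>)
  then have "order R * card {b \<in> V. B a b = \<zero>} = order R * order R ^ (d - 2)"
    by (simp add: card_V power_dim(2))
  then show ?thesis using order_gt_1 by simp
qed

text \<open>The substitution \<open>(x, y) \<mapsto> (x - y, x + y)\<close> turns \<open>Q x = Q y\<close> into orthogonality.\<close>

lemma card_equal_values_le:
  "card {(x, y). x \<in> V \<and> y \<in> V \<and> Q x = Q y} \<le> card {(a, b). a \<in> V \<and> b \<in> V \<and> B a b = \<zero>}"
proof (rule card_inj_on_le[where f = "\<lambda>(x, y). (x \<ominus>\<^bsub>M\<^esub> y, x \<oplus>\<^bsub>M\<^esub> y)"])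
  show "inj_on (\<lambda>(x, y). (x \<ominus>\<^bsub>M\<^esub> y, x \<oplus>\<^bsub>M\<^esub> y)) {(x, y). x \<in> V \<and> y \<in> V \<and> Q x = Q y}"
  proof (rule inj_onI, clarify)
    fix x y x' y'
    assume m: "x \<in> V" "y \<in> V" "x' \<in> V" "y' \<in> V"
      and e1: "x \<ominus>\<^bsub>M\<^esub> y = x' \<ominus>\<^bsub>M\<^esub> y'" and e2: "x \<oplus>\<^bsub>M\<^esub> y = x' \<oplus>\<^bsub>M\<^esub> y'"
    \<comment> \<open>Odd order makes 2 invertible, so \<open>x\<close> is half the sum of the two
      new coordinates.\<close>
    define t where "t = \<one> \<oplus> \<one>"
    have t: "t \<in> carrier R" "inv t \<in> carrier R" "inv t \<otimes> t = \<one>"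
      using double_nonzero[of \<one>] field_Units by (auto simp: t_def)
    have cancel: "inv t \<odot>\<^bsub>M\<^esub> ((x \<ominus>\<^bsub>M\<^esub> y) \<oplus>\<^bsub>M\<^esub> (x \<oplus>\<^bsub>M\<^esub> y)) = x"
      if "x \<in> V" "y \<in> V" for x y
    proof -
      have xy: "x \<in> carrier M" "y \<in> carrier M" using that by simp_all
      have "(x \<ominus>\<^bsub>M\<^esub> y) \<oplus>\<^bsub>M\<^esub> (x \<oplus>\<^bsub>M\<^esub> y) = (x \<oplus>\<^bsub>M\<^esub> \<ominus>\<^bsub>M\<^esub> y) \<oplus>\<^bsub>M\<^esub> (y \<oplus>\<^bsub>M\<^esub> x)"
        unfolding a_minus_def by (rule arg_cong[OF M.a_comm[OF xy]])
      also have "\<dots> = x \<oplus>\<^bsub>M\<^esub> x" using xy by (simp add: M.a_assoc M.r_neg1)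
      also have "\<dots> = t \<odot>\<^bsub>M\<^esub> x" using xy by (simp add: t_def smult_l_distr)
      finally have "inv t \<odot>\<^bsub>M\<^esub> ((x \<ominus>\<^bsub>M\<^esub> y) \<oplus>\<^bsub>M\<^esub> (x \<oplus>\<^bsub>M\<^esub> y)) = inv t \<odot>\<^bsub>M\<^esub> (t \<odot>\<^bsub>M\<^esub> x)"
        by simp
      then show ?thesis using smult_assoc1[of "inv t" t x] t xy by simp
    qed
    have xx: "x = x'"
      using cancel[OF m(1,2)] cancel[OF m(3,4)] unfolding e1 e2 by simp
    then show "x = x' \<and> y = y'" using e2 m by simp
  qed
  show "(\<lambda>(x, y). (x \<ominus>\<^bsub>M\<^esub> y, x \<oplus>\<^bsub>M\<^esub> y)) ` {(x, y). x \<in> V \<and> y \<in> V \<and> Q x = Q y}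
    \<subseteq> {(a, b). a \<in> V \<and> b \<in> V \<and> B a b = \<zero>}"
  proof clarsimp
    fix x y assume m: "x \<in> V" "y \<in> V" "Q x = Q y"
    have "B (x \<ominus>\<^bsub>M\<^esub> y) (x \<oplus>\<^bsub>M\<^esub> y) = (Q x \<ominus> B x y) \<oplus> (B x y \<ominus> Q x)"
      using m B_commute[of y x] by (simp add: form_simps B_self)
    also have "\<dots> = \<zero>" using Q_closed[of x] B_closed[of x y] m(1,2) V_closed by algebra
    finally show "x \<ominus>\<^bsub>M\<^esub> y \<in> V \<and> x \<oplus>\<^bsub>M\<^esub> y \<in> V \<and> B (x \<ominus>\<^bsub>M\<^esub> y) (x \<oplus>\<^bsub>M\<^esub> y) = \<zero>"
      using m V_add V_diff by simp
  qed
  show "finite {(a, b). a \<in> V \<and> b \<in> V \<and> B a b = \<zero>}"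
    by (rule finite_subset[of _ "V \<times> V"]) (auto simp: finite_V)
qed

text \<open>Each \<open>a\<close> in \<open>V\<close> has \<open>q ^ (d - 2)\<close> orthogonal
  partners, and the elements of the radical, at most \<open>q\<close> in number, have the excess
  \<open>q ^ (d - 1) - q ^ (d - 2)\<close>.\<close>

lemma card_orthogonal_pairs_le:
  "real (card {(a, b). a \<in> V \<and> b \<in> V \<and> B a b = \<zero>})
    \<le> real (order R) * real (order R) ^ (d - 2) * real (order R) ^ (d - 2)
      + real (order R) * (real (order R) ^ (d - 1) - real (order R) ^ (d - 2))"
proof -
  let ?q = "real (order R)"
  have "{(a, b). a \<in> V \<and> b \<in> V \<and> B a b = \<zero>} = Sigma V (\<lambda>a. {b \<in> V. B a b = \<zero>})" by auto
  then have "real (card {(a, b). a \<in> V \<and> b \<in> V \<and> B a b = \<zero>})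
      = (\<Sum>a\<in>V. real (card {b \<in> V. B a b = \<zero>}))"
    using finite_V by simp
  also have "\<dots> = (\<Sum>a\<in>V. ?q ^ (d - 2) + (if a \<in> rad then ?q ^ (d - 1) - ?q ^ (d - 2) else 0))"
  proof (rule sum.cong[OF refl])
    fix a assume "a \<in> V"
    moreover have "{b \<in> V. B a b = \<zero>} = V" if "a \<in> rad" using that by (auto simp: rad_def)
    ultimately show "real (card {b \<in> V. B a b = \<zero>})
        = ?q ^ (d - 2) + (if a \<in> rad then ?q ^ (d - 1) - ?q ^ (d - 2) else 0)"
      using card_orthogonal_V[of a] card_V by auto
  qed
  also have "\<dots> = card V * ?q ^ (d - 2) + card rad * (?q ^ (d - 1) - ?q ^ (d - 2))"
  proof -
    have "V \<inter> rad = rad" by (auto simp: rad_def)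
    then show ?thesis using finite_V by (simp add: sum.distrib sum.If_cases)
  qed
  also have "\<dots> \<le> card V * ?q ^ (d - 2) + ?q * (?q ^ (d - 1) - ?q ^ (d - 2))"
    using card_rad_le order_gt_1 by (intro add_left_mono mult_right_mono) (auto intro: power_increasing)
  also have "real (card V) = ?q * ?q ^ (d - 2)"
    by (simp add: card_V power_dim(2))
  finally show ?thesis .
qed

lemma finite_level: "finite (level r)"
  using finite_V by (simp add: level_def)

lemma sum_card_level: "(\<Sum>r\<in>carrier R. real (card (level r))) = real (order R) ^ (d - 1)"
proof -
  have "(\<Sum>r\<in>carrier R. \<Sum>y\<in>{y \<in> V. Q y = r}. 1::real) = (\<Sum>y\<in>V. 1)"
    by (rule sum.group) (use finite_V finite_R in auto)
  then show ?thesis by (simp add: level_def card_V)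
qed

lemma sum_card_level_squared:
  "(\<Sum>r\<in>carrier R. real (card (level r)) ^ 2)
    = real (card {(x, y). x \<in> V \<and> y \<in> V \<and> Q x = Q y})"
proof -
  have "{(x, y). x \<in> V \<and> y \<in> V \<and> Q x = Q y} = (\<Union>r\<in>carrier R. level r \<times> level r)"
    by (auto simp: level_def)
  moreover have "card (\<Union>r\<in>carrier R. level r \<times> level r) = (\<Sum>r\<in>carrier R. card (level r \<times> level r))"
    by (rule card_UN_disjoint) (use finite_R finite_level in \<open>auto simp: level_def\<close>)
  ultimately show ?thesis by (simp add: card_cartesian_product power2_eq_square)
qed

text \<open>Let \<open>m = q ^ (d - 2)\<close>, the exact mean of the level sizes. The second moment
  is at most \<open>q m^2 + q (q m - m)\<close>; centring removes exactly \<open>q m^2\<close>, and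
  what remains is the contribution of the radical.\<close>

lemma sum_level_variance_le:
  "(\<Sum>r\<in>carrier R. (real (card (level r)) - real (order R) ^ (d - 2)) ^ 2)
    \<le> real (order R) ^ (d - 1) * (real (order R) - 1)"
proof -
  define q where "q = real (order R)"
  define m where "m = q ^ (d - 2)"
  have qm: "q ^ (d - Suc 0) = q * m"
    by (simp add: m_def power_dim(2))
  have "(\<Sum>r\<in>carrier R. (real (card (level r)) - m) ^ 2)
      = (\<Sum>r\<in>carrier R. real (card (level r)) ^ 2 - 2 * m * real (card (level r)) + m ^ 2)"
    by (simp add: power2_diff algebra_simps)
  also have "\<dots> = (\<Sum>r\<in>carrier R. real (card (level r)) ^ 2)
      - 2 * m * (\<Sum>r\<in>carrier R. real (card (level r))) + q * m ^ 2"
    by (simp add: sum.distrib sum_subtractf sum_distrib_left q_def order_def)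
  also have "\<dots> \<le> (q * m * m + q * (q * m - m)) - 2 * m * (q * m) + q * m ^ 2"
    using order_trans[OF _ card_orthogonal_pairs_le, of "real (card {(x, y). x \<in> V \<and> y \<in> V \<and> Q x = Q y})"]
      card_equal_values_le qm
    by (simp add: mult_ac sum_card_level_squared sum_card_level flip: q_def m_def)
  also have "\<dots> = q * m * (q - 1)" by (simp add: algebra_simps power2_eq_square)
  finally show ?thesis by (simp add: qm flip: q_def m_def)
qed

text \<open>Scaling by \<open>s\<close> preserves \<open>V\<close> and multiplies \<open>Q\<close>
  by the square of \<open>s\<close>; scaling by \<open>inv s\<close> undoes it.\<close>

lemma card_level_square_mult:
  assumes s: "s \<in> carrier R" "s \<noteq> \<zero>" and r: "r \<in> carrier R"
  shows "card (level (s \<otimes> s \<otimes> r)) = card (level r)"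
proof -
  have iv: "inv s \<in> carrier R" "s \<otimes> inv s = \<one>" "inv s \<otimes> s = \<one>" using s field_Units by auto
  have "bij_betw (\<lambda>y. s \<odot>\<^bsub>M\<^esub> y) (level r) (level (s \<otimes> s \<otimes> r))"
  proof (rule bij_betw_byWitness[where f' = "\<lambda>y. inv s \<odot>\<^bsub>M\<^esub> y"])
    have "inv s \<otimes> inv s \<otimes> (s \<otimes> s \<otimes> r) = (inv s \<otimes> s) \<otimes> (inv s \<otimes> s) \<otimes> r"
      using iv(1) s(1) r by algebra
    then have "inv s \<otimes> inv s \<otimes> (s \<otimes> s \<otimes> r) = r" using iv r by simp
    then show "(\<odot>\<^bsub>M\<^esub>) (inv s) ` level (s \<otimes> s \<otimes> r) \<subseteq> level r"
      using iv(1) by (auto simp: level_def V_smult Q_smult)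
    show "(\<odot>\<^bsub>M\<^esub>) s ` level r \<subseteq> level (s \<otimes> s \<otimes> r)"
      using s(1) by (auto simp: level_def V_smult Q_smult)
    show "\<forall>y\<in>level r. inv s \<odot>\<^bsub>M\<^esub> (s \<odot>\<^bsub>M\<^esub> y) = y"
      using iv s(1) smult_assoc1[of "inv s" s] by (simp add: level_def)
    show "\<forall>y\<in>level (s \<otimes> s \<otimes> r). s \<odot>\<^bsub>M\<^esub> (inv s \<odot>\<^bsub>M\<^esub> y) = y"
      using iv s(1) smult_assoc1[of s "inv s"] by (simp add: level_def)
  qed
  then show ?thesis by (simp add: bij_betw_same_card)
qed

text \<open>The level sizes are constant on the square class of \<open>r\<close>, that is on about half of the field,
  so the variance bound is a bound for each of them.\<close>

lemma card_level_deviation: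
  assumes r: "r \<in> carrier R" "r \<noteq> \<zero>"
  shows "(real (card (level r)) - real (order R) ^ (d - 2)) ^ 2 \<le> 2 * real (order R) ^ (d - 1)"
proof -
  define h where "h x = (real (card (level x)) - real (order R) ^ (d - 2)) ^ 2" for x
  have h0: "h x \<ge> 0" for x by (simp add: h_def)
  \<comment> \<open>Averaging over the multiplier \<open>s\<close> instead of over the square class:
    all summands equal \<open>h r\<close>, and regrouping by
    \<open>x = s \<otimes> s \<otimes> r\<close> covers each \<open>x\<close> at most twice, whence
    the factor 2.\<close>
  have "(real (order R) - 1) * h r = (\<Sum>s\<in>carrier R - {\<zero>}. h (s \<otimes> s \<otimes> r))"
  proof -
    have "(\<Sum>s\<in>carrier R - {\<zero>}. h (s \<otimes> s \<otimes> r)) = (\<Sum>s\<in>carrier R - {\<zero>}. h r)"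
      by (rule sum.cong) (auto simp: h_def card_level_square_mult r)
    then show ?thesis using order_gt_1 finite_R by (simp add: card_Diff_singleton order_def of_nat_diff)
  qed
  also have "\<dots> = (\<Sum>x\<in>carrier R. \<Sum>s\<in>{s \<in> carrier R - {\<zero>}. s \<otimes> s \<otimes> r = x}. h (s \<otimes> s \<otimes> r))"
    by (rule sum.group[symmetric]) (use finite_R r in auto)
  also have "\<dots> = (\<Sum>x\<in>carrier R. card {s \<in> carrier R - {\<zero>}. s \<otimes> s \<otimes> r = x} * h x)"
  proof (rule sum.cong[OF refl])
    fix x
    have "(\<Sum>s\<in>{s \<in> carrier R - {\<zero>}. s \<otimes> s \<otimes> r = x}. h (s \<otimes> s \<otimes> r))
        = (\<Sum>s\<in>{s \<in> carrier R - {\<zero>}. s \<otimes> s \<otimes> r = x}. h x)"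
      by (rule sum.cong) auto
    then show "(\<Sum>s\<in>{s \<in> carrier R - {\<zero>}. s \<otimes> s \<otimes> r = x}. h (s \<otimes> s \<otimes> r))
        = card {s \<in> carrier R - {\<zero>}. s \<otimes> s \<otimes> r = x} * h x" by simp
  qed
  also have "\<dots> \<le> (\<Sum>x\<in>carrier R. 2 * h x)"
  proof (intro sum_mono mult_right_mono h0)
    fix x assume x: "x \<in> carrier R"
    \<comment> \<open>A quadratic equation in \<open>s\<close> whose leading coefficient
      \<open>r\<close> is nonzero; the zero terms only bring it into the general shape.\<close>
    have "card {s \<in> carrier R - {\<zero>}. s \<otimes> s \<otimes> r = x}
        \<le> card {s \<in> carrier R. \<zero> \<oplus> s \<otimes> \<zero> \<oplus> s \<otimes> s \<otimes> r = x}"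
      by (rule card_mono) (use finite_R r in auto)
    also have "\<dots> \<le> 2" by (rule card_quadratic_roots_le) (use r x in auto)
    finally show "real (card {s \<in> carrier R - {\<zero>}. s \<otimes> s \<otimes> r = x}) \<le> 2" by simp
  qed
  also have "\<dots> \<le> (real (order R) - 1) * (2 * real (order R) ^ (d - 1))"
    using sum_level_variance_le by (simp add: h_def algebra_simps flip: sum_distrib_left)
  finally show ?thesis using order_gt_1 by (simp add: h_def)
qed

text \<open>If \<open>Q\<close> vanished on \<open>V\<close>, then by polarization so would
  \<open>B\<close>, and \<open>V\<close> would be its own radical. That is too small, because
  \<open>d - 1 > 1\<close>.\<close>

lemma ex_anisotropic_V: "\<exists>y\<in>V. Q y \<noteq> \<zero>"
proof (rule ccontr)
  assume "\<not> ?thesis"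
  then have Q0: "Q y = \<zero>" if "y \<in> V" for y using that by blast
  have "B a b = \<zero>" if "a \<in> V" "b \<in> V" for a b
  proof (rule ccontr)
    assume "B a b \<noteq> \<zero>"
    then have "B a b \<oplus> B a b \<noteq> \<zero>" using that by (intro double_nonzero) auto
    moreover have "Q (a \<oplus>\<^bsub>M\<^esub> b) = \<zero>" using Q0 V_add that by blast
    ultimately show False using that Q0 by (simp add: Q_add)
  qed
  then have "V = rad" by (auto simp: rad_def)
  then have "order R ^ (d - 1) \<le> order R ^ 1" using card_rad_le card_V by simp
  moreover have "order R ^ 1 < order R ^ (d - 1)"
    using dim_ge_3 order_gt_1 by (intro power_strict_increasing) auto
  ultimately show False by simp
qed

text \<open>Here \<open>V\<close> is the plane of all \<open>s y + t v\<close>: pairing with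
  \<open>y\<close> and then with \<open>w\<close> recovers \<open>s\<close> and \<open>t\<close>,
  and both sides have \<open>q ^ 2\<close> elements. On it \<open>Q\<close> is the square of
  \<open>s\<close> times \<open>Q y\<close>, so the level consists of the two lines
  \<open>s = 1\<close> and \<open>s = -1\<close>.\<close>

lemma card_level_dim_3:
  assumes d: "d = 3" and y: "y \<in> V" "Q y \<noteq> \<zero>"
  shows "card (level (Q y)) = 2 * order R"
proof -
  let ?g = "\<lambda>(s, t). s \<odot>\<^bsub>M\<^esub> y \<oplus>\<^bsub>M\<^esub> t \<odot>\<^bsub>M\<^esub> v"
  have ym: "y \<in> carrier M" using y by simp
  have Byv: "B y v = \<zero>" "B v y = \<zero>" using B_V_v y by auto
  have Qg: "Q (s \<odot>\<^bsub>M\<^esub> y \<oplus>\<^bsub>M\<^esub> t \<odot>\<^bsub>M\<^esub> v) = s \<otimes> s \<otimes> Q y" if "s \<in> carrier R" "t \<in> carrier R" for s t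
    using that ym by (simp add: form_simps Byv Q_v)
  have inj: "inj_on ?g (carrier R \<times> carrier R)"
  proof (rule inj_onI, clarify)
    fix s t s' t'
    assume m: "s \<in> carrier R" "t \<in> carrier R" "s' \<in> carrier R" "t' \<in> carrier R"
      and e: "s \<odot>\<^bsub>M\<^esub> y \<oplus>\<^bsub>M\<^esub> t \<odot>\<^bsub>M\<^esub> v = s' \<odot>\<^bsub>M\<^esub> y \<oplus>\<^bsub>M\<^esub> t' \<odot>\<^bsub>M\<^esub> v"
    have "B (s \<odot>\<^bsub>M\<^esub> y \<oplus>\<^bsub>M\<^esub> t \<odot>\<^bsub>M\<^esub> v) y = B (s' \<odot>\<^bsub>M\<^esub> y \<oplus>\<^bsub>M\<^esub> t' \<odot>\<^bsub>M\<^esub> v) y"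
      using e by simp
    then have "s \<otimes> Q y = s' \<otimes> Q y" using m ym by (simp add: form_simps Byv B_self)
    then have ss: "s = s'" using y m ym R.m_rcancel[of "Q y" s s'] by simp
    have "B (s \<odot>\<^bsub>M\<^esub> y \<oplus>\<^bsub>M\<^esub> t \<odot>\<^bsub>M\<^esub> v) w = B (s' \<odot>\<^bsub>M\<^esub> y \<oplus>\<^bsub>M\<^esub> t' \<odot>\<^bsub>M\<^esub> v) w"
      using e by simp
    then have "t = t'" using m ym ss by (simp add: form_simps B_v_w)
    then show "s = s' \<and> t = t'" using ss by simp
  qed
  have "?g ` (carrier R \<times> carrier R) = V"
  proof (rule card_subset_eq[OF finite_V])
    show "?g ` (carrier R \<times> carrier R) \<subseteq> V" using y v_in_V by (auto simp: V_add V_smult)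
    show "card (?g ` (carrier R \<times> carrier R)) = card V"
      using card_image[OF inj] by (simp add: card_cartesian_product card_V d power2_eq_square order_def)
  qed
  then have "level (Q y) = {x \<in> ?g ` (carrier R \<times> carrier R). Q x = Q y}" by (simp add: level_def)
  also have "\<dots> = ?g ` {p \<in> carrier R \<times> carrier R. Q (?g p) = Q y}" by blast
  also have "{p \<in> carrier R \<times> carrier R. Q (?g p) = Q y}
      = {(s, t). s \<in> carrier R \<and> t \<in> carrier R \<and> s \<otimes> s \<otimes> Q y = Q y}"
    by (auto simp: Qg)
  also have "{(s, t). s \<in> carrier R \<and> t \<in> carrier R \<and> s \<otimes> s \<otimes> Q y = Q y}
      = {\<one>, \<ominus> \<one>} \<times> carrier R"
  proof -
    have "s \<otimes> s \<otimes> Q y = Q y \<longleftrightarrow> s = \<one> \<or> s = \<ominus> \<one>" if s: "s \<in> carrier R" for s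
    proof -
      have "s \<otimes> s \<otimes> Q y = Q y \<longleftrightarrow> s \<otimes> s = \<one>"
        using y s ym R.m_rcancel[of "Q y" "s \<otimes> s" \<one>] by simp
      also have "\<dots> \<longleftrightarrow> s = \<one> \<or> s = \<ominus> \<one>"
        using square_eq_one[OF s] by (auto simp: l_minus r_minus)
      finally show ?thesis .
    qed
    then show ?thesis by auto
  qed
  finally have "card (level (Q y)) = card ({\<one>, \<ominus> \<one>} \<times> carrier R)"
    using card_image[OF inj_on_subset[OF inj, of "{\<one>, \<ominus> \<one>} \<times> carrier R"]] by fastforce
  also have "\<dots> = card {\<one>, \<ominus> \<one>} * order R"
    unfolding order_def by (rule card_cartesian_product)
  also have "card {\<one>, \<ominus> \<one>} = 2"
  proof -
    have "\<one> \<noteq> \<ominus> \<one>"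
    proof
      assume "\<one> = \<ominus> \<one>"
      then have "\<one> \<oplus> \<one> = \<one> \<oplus> \<ominus> \<one>" by (rule arg_cong)
      also have "\<dots> = \<zero>" by (simp add: R.r_neg)
      finally show False using double_nonzero[of \<one>] by simp
    qed
    then show ?thesis by (rule card_2_iff[THEN iffD2, OF exI, OF exI, OF conjI[OF refl]])
  qed
  finally show ?thesis .
qed

subsection \<open>Hyperplane sections of the levels\<close>

text \<open>If \<open>Q\<close> is nonconstant on all lines of the section in some fixed direction, each such line meets
  the level in at most two points. Otherwise the direction space of the section is totally isotropic
  and orthogonal to a point of the level, hence to all of \<open>V\<close>; the radical is too small for that.\<close>

lemma card_level_section_le:
  assumes d: "d \<ge> 4" and r: "r \<in> carrier R" "r \<noteq> \<zero>" and c: "c \<in> carrier R"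
    and f_closed: "\<And>x. x \<in> V \<Longrightarrow> f x \<in> carrier R"
    and f_add: "\<And>x y. \<lbrakk>x \<in> V; y \<in> V\<rbrakk> \<Longrightarrow> f (x \<oplus>\<^bsub>M\<^esub> y) = f x \<oplus> f y"
    and f_smult: "\<And>s x. \<lbrakk>s \<in> carrier R; x \<in> V\<rbrakk> \<Longrightarrow> f (s \<odot>\<^bsub>M\<^esub> x) = s \<otimes> f x"
    and f_nz: "\<exists>x\<in>V. f x \<noteq> \<zero>"
  shows "card {y \<in> level r. f y = c} \<le> 2 * order R ^ (d - 3)"
proof -
  \<comment> \<open>\<open>W c\<close> is the section of \<open>V\<close> and
    \<open>W \<zero>\<close> its direction space.\<close>
  define W where "W b = {y \<in> V. f y = b}" for b
  define T where "T = {y \<in> level r. f y = c}"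
  have W_V: "y \<in> V" if "y \<in> W b" for y b using that by (simp add: W_def)
  have card_W: "card (W b) = order R ^ (d - 2)" if b: "b \<in> carrier R" for b
  proof -
    obtain e where e: "e \<in> V" "f e \<noteq> \<zero>" using f_nz by blast
    have "order R * card {y \<in> V. f y = b} = card V"
      by (rule order_mult_card_fibre[where e = e and a = "f e"])
        (use e b in \<open>auto simp: f_closed f_add f_smult V_add V_smult V_subset\<close>)
    then have "order R * card (W b) = order R * order R ^ (d - 2)"
      by (simp add: W_def card_V power_dim(2))
    then show ?thesis using order_gt_1 by simp
  qed
  \<comment> \<open>The condition on \<open>e\<close> makes \<open>Q\<close> nonconstant on every
    line of \<open>W c\<close> parallel to \<open>e\<close>. The double count has
    \<open>q * q ^ (d - 3)\<close> base points in \<open>W c\<close> with at most two hits each, and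
    the factor \<open>q\<close> cancels.\<close>
  have lines: "card T \<le> 2 * order R ^ (d - 3)"
    if e: "e \<in> W \<zero>" and lin: "\<And>y. y \<in> W c \<Longrightarrow> Q e \<noteq> \<zero> \<or> B y e \<noteq> \<zero>" for e
  proof -
    have eV: "e \<in> V" "f e = \<zero>" using e by (auto simp: W_def)
    have "order R * card T
        = (\<Sum>y\<in>W c. card {s \<in> carrier R. y \<oplus>\<^bsub>M\<^esub> s \<odot>\<^bsub>M\<^esub> e \<in> T})"
      by (rule order_mult_card_eq)
        (use eV c in \<open>auto simp: W_def T_def level_def f_closed f_add f_smult V_add V_smult\<close>)
    also have "\<dots> \<le> (\<Sum>y\<in>W c. 2)"
    proof (rule sum_mono)
      fix y assume y: "y \<in> W c"
      have "card {s \<in> carrier R. y \<oplus>\<^bsub>M\<^esub> s \<odot>\<^bsub>M\<^esub> e \<in> T}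
          \<le> card {s \<in> carrier R. Q (y \<oplus>\<^bsub>M\<^esub> s \<odot>\<^bsub>M\<^esub> e) = r}"
        by (rule card_mono) (use finite_R in \<open>auto simp: T_def level_def\<close>)
      also have "\<dots> \<le> 2"
        by (rule card_sphere_line_le) (use y eV lin r W_V in auto)
      finally show "card {s \<in> carrier R. y \<oplus>\<^bsub>M\<^esub> s \<odot>\<^bsub>M\<^esub> e \<in> T} \<le> 2" .
    qed
    also have "\<dots> = order R * (2 * order R ^ (d - 3))"
      using card_W[OF c] by (simp add: power_dim(3))
    finally show ?thesis using order_gt_1 by simp
  qed
  show ?thesis
  proof (cases "\<exists>e\<in>W \<zero>. Q e \<noteq> \<zero>")
    case True
    then show ?thesis using lines unfolding T_def by blast
  next
    case False
    \<comment> \<open>From here on \<open>Q\<close>, and by polarization also \<open>B\<close>,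
      vanishes on \<open>W \<zero>\<close>; a usable direction must now come from the linear term
      alone.\<close>
    then have Q0: "Q e = \<zero>" if "e \<in> W \<zero>" for e using that by blast
    have W_add: "x \<oplus>\<^bsub>M\<^esub> y \<in> W \<zero>" if "x \<in> W \<zero>" "y \<in> W \<zero>" for x y
      using that by (simp add: W_def V_add f_add)
    have B0: "B x y = \<zero>" if xy: "x \<in> W \<zero>" "y \<in> W \<zero>" for x y
    proof (rule ccontr)
      assume "B x y \<noteq> \<zero>"
      moreover have m: "x \<in> carrier M" "y \<in> carrier M" using xy W_V by auto
      ultimately have "B x y \<oplus> B x y \<noteq> \<zero>" by (intro double_nonzero) auto
      then show False using Q0[OF W_add[OF xy]] Q0[OF xy(1)] Q0[OF xy(2)] m by (simp add: Q_add)
    qed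
    \<comment> \<open>A point \<open>g\<close> of \<open>T\<close> has
      \<open>Q g = r \<noteq> \<zero>\<close>, so it lies outside \<open>W \<zero>\<close> and
      together with it spans \<open>V\<close>. If \<open>g\<close> is orthogonal to
      \<open>W \<zero>\<close>, then \<open>W \<zero>\<close> lies in the radical, although it has
      \<open>q ^ (d - 2) > q\<close> elements.\<close>
    have T_empty: "T = {}" if orth: "\<And>g e. \<lbrakk>g \<in> T; e \<in> W \<zero>\<rbrakk> \<Longrightarrow> B g e = \<zero>"
    proof (rule ccontr)
      assume "T \<noteq> {}"
      then obtain g where g: "g \<in> T" by blast
      have gV: "g \<in> V" "Q g = r" "f g = c" using g by (auto simp: T_def level_def)
      have "c \<noteq> \<zero>" using Q0[of g] gV r by (auto simp: W_def)
      then have ic: "inv c \<in> carrier R" "inv c \<otimes> c = \<one>" using c field_Units by auto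
      have "W \<zero> \<subseteq> rad"
      proof
        fix e assume e: "e \<in> W \<zero>"
        have "B e b = \<zero>" if b: "b \<in> V" for b
        proof -
          \<comment> \<open>Chosen so that \<open>b - ?s g\<close> lies in the kernel of
            \<open>f\<close>.\<close>
          let ?s = "f b \<otimes> inv c"
          have s: "?s \<in> carrier R" using f_closed b ic by simp
          have sg: "(\<ominus> ?s) \<odot>\<^bsub>M\<^esub> g \<in> V" using s gV V_smult by simp
          have "f (b \<oplus>\<^bsub>M\<^esub> (\<ominus> ?s) \<odot>\<^bsub>M\<^esub> g) = f b \<oplus> (\<ominus> ?s) \<otimes> c"
            using f_add[OF b sg] f_smult[of "\<ominus> ?s" g] s gV by simp
          also have "\<dots> = f b \<ominus> f b \<otimes> (inv c \<otimes> c)"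
            using f_closed[OF b] ic(1) c by algebra
          also have "\<dots> = \<zero>" using f_closed[OF b] ic by simp
          finally have "b \<oplus>\<^bsub>M\<^esub> (\<ominus> ?s) \<odot>\<^bsub>M\<^esub> g \<in> W \<zero>"
            using V_add[OF b sg] by (simp add: W_def)
          then have "B e (b \<oplus>\<^bsub>M\<^esub> (\<ominus> ?s) \<odot>\<^bsub>M\<^esub> g) = \<zero>" by (rule B0[OF e])
          moreover have "B e g = \<zero>" using orth[OF g e] B_commute[of e g] W_V[OF e] gV by simp
          moreover have "\<ominus> ?s \<in> carrier R" using s by simp
          ultimately show ?thesis using b W_V[OF e] gV s by (simp add: B_add_right B_smult_right)
        qed
        then show "e \<in> rad" using W_V[OF e] by (simp add: rad_def)
      qed
      then have "card (W \<zero>) \<le> card rad"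
        by (rule card_mono[rotated]) (simp add: rad_def finite_V)
      then have "order R ^ (d - 2) \<le> order R ^ 1" using card_rad_le card_W by simp
      moreover have "order R ^ 1 < order R ^ (d - 2)"
        using d order_gt_1 by (intro power_strict_increasing) auto
      ultimately show False by simp
    qed
    show ?thesis
    proof (cases "\<exists>g\<in>T. \<exists>e\<in>W \<zero>. B g e \<noteq> \<zero>")
      case True
      then obtain g e where g: "g \<in> T" and e: "e \<in> W \<zero>" and ge: "B g e \<noteq> \<zero>" by blast
      have gV: "g \<in> V" "f g = c" using g by (auto simp: T_def level_def)
      \<comment> \<open>Differences of points of \<open>W c\<close> lie in the totally isotropic
        space \<open>W \<zero>\<close>, so pairing with \<open>e\<close> is constant on
        \<open>W c\<close>, with the nonzero value \<open>B g e\<close>.\<close>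
      have "B y e \<noteq> \<zero>" if y: "y \<in> W c" for y
      proof -
        have yV: "y \<in> V" "f y = c" using y by (auto simp: W_def)
        have "(\<ominus> \<one>) \<odot>\<^bsub>M\<^esub> g \<in> V" "f ((\<ominus> \<one>) \<odot>\<^bsub>M\<^esub> g) = \<ominus> c"
          using gV f_smult[of "\<ominus> \<one>" g] c by (auto simp: V_smult l_minus)
        then have "y \<oplus>\<^bsub>M\<^esub> (\<ominus> \<one>) \<odot>\<^bsub>M\<^esub> g \<in> W \<zero>"
          using yV c V_add by (simp add: W_def f_add R.r_neg)
        then have "B (y \<oplus>\<^bsub>M\<^esub> (\<ominus> \<one>) \<odot>\<^bsub>M\<^esub> g) e = \<zero>" by (rule B0[OF _ e])
        then have "B y e \<ominus> B g e = \<zero>"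
          using yV gV W_V[OF e] by (simp add: B_add_left B_smult_left l_minus a_minus_def)
        then show ?thesis using ge yV gV W_V[OF e] by auto
      qed
      then show ?thesis using lines[OF e] unfolding T_def by blast
    next
      case False
      then have "T = {}" by (intro T_empty) blast
      then have "card T \<le> 2 * order R ^ (d - 3)" by simp
      then show ?thesis by (simp only: T_def)
    qed
  qed
qed

subsection \<open>Slices and the spheres through their points\<close>

definition slice :: "'a \<Rightarrow> 'a \<Rightarrow> 'c set" where
  "slice r z = (\<lambda>y. z \<odot>\<^bsub>M\<^esub> w \<oplus>\<^bsub>M\<^esub> y) ` level r"

definition center :: "'a \<Rightarrow> 'a \<Rightarrow> 'c" where
  "center z u = z \<odot>\<^bsub>M\<^esub> w \<oplus>\<^bsub>M\<^esub> u \<odot>\<^bsub>M\<^esub> v"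

lemma center_closed [simp, intro]:
  "\<lbrakk>z \<in> carrier R; u \<in> carrier R\<rbrakk> \<Longrightarrow> center z u \<in> carrier M"
  by (simp add: center_def)

text \<open>Since \<open>V\<close> is orthogonal to \<open>v\<close> and
  \<open>B w v = \<one>\<close>, pairing with \<open>v\<close> reads off the height
  \<open>z\<close>. In this form slices of different heights are visibly disjoint.\<close>

lemma slice_eq:
  assumes z: "z \<in> carrier R"
  shows "slice r z = {x \<in> carrier M. B x v = z \<and> Q (x \<ominus>\<^bsub>M\<^esub> z \<odot>\<^bsub>M\<^esub> w) = r}"
proof (intro equalityI subsetI)
  have zw: "z \<odot>\<^bsub>M\<^esub> w \<in> carrier M" using z by simp
  fix x
  assume "x \<in> slice r z"
  then obtain y where y: "y \<in> V" "Q y = r" and x: "x = z \<odot>\<^bsub>M\<^esub> w \<oplus>\<^bsub>M\<^esub> y"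
    by (auto simp: slice_def level_def)
  have ym: "y \<in> carrier M" using y by simp
  have "x \<ominus>\<^bsub>M\<^esub> z \<odot>\<^bsub>M\<^esub> w = y \<oplus>\<^bsub>M\<^esub> z \<odot>\<^bsub>M\<^esub> w \<ominus>\<^bsub>M\<^esub> z \<odot>\<^bsub>M\<^esub> w"
    unfolding x using M.a_comm[OF zw ym] by simp
  also have "\<dots> = y" using zw ym by (simp add: a_minus_def M.a_assoc M.r_neg)
  finally show "x \<in> {x \<in> carrier M. B x v = z \<and> Q (x \<ominus>\<^bsub>M\<^esub> z \<odot>\<^bsub>M\<^esub> w) = r}"
    using y ym z by (simp add: x form_simps B_V_v B_w_v)
next
  have zw: "z \<odot>\<^bsub>M\<^esub> w \<in> carrier M" using z by simp
  fix x
  assume "x \<in> {x \<in> carrier M. B x v = z \<and> Q (x \<ominus>\<^bsub>M\<^esub> z \<odot>\<^bsub>M\<^esub> w) = r}"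
  then have x: "x \<in> carrier M" "B x v = z" "Q (x \<ominus>\<^bsub>M\<^esub> z \<odot>\<^bsub>M\<^esub> w) = r" by auto
  let ?y = "x \<ominus>\<^bsub>M\<^esub> z \<odot>\<^bsub>M\<^esub> w"
  have "?y \<in> carrier M" "B ?y v = \<zero>" using x z by (auto simp: B_diff_left B_smult_left B_w_v)
  then have "?y \<in> level r" using x(3) by (simp add: level_def V_def del: V_closed)
  moreover have "x = z \<odot>\<^bsub>M\<^esub> w \<oplus>\<^bsub>M\<^esub> ?y"
    using M.a_comm[OF zw \<open>?y \<in> carrier M\<close>] x(1) zw by (simp add: a_minus_def M.a_assoc M.l_neg)
  ultimately show "x \<in> slice r z" unfolding slice_def by blast
qed

lemma slice_closed: "\<lbrakk>z \<in> carrier R; x \<in> slice r z\<rbrakk> \<Longrightarrow> x \<in> carrier M"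
  and B_slice: "\<lbrakk>z \<in> carrier R; x \<in> slice r z\<rbrakk> \<Longrightarrow> B x v = z"
  by (simp_all add: slice_eq)

lemma finite_slice: "finite (slice r z)"
  by (simp add: slice_def finite_level)

lemma card_slice:
  assumes "z \<in> carrier R"
  shows "card (slice r z) = card (level r)"
  unfolding slice_def
proof (rule card_image, rule inj_onI)
  fix x y assume "x \<in> level r" "y \<in> level r" "z \<odot>\<^bsub>M\<^esub> w \<oplus>\<^bsub>M\<^esub> x = z \<odot>\<^bsub>M\<^esub> w \<oplus>\<^bsub>M\<^esub> y"
  then show "x = y" using assms by (simp add: level_def)
qed

lemma card_Union_slice:
  assumes "Z \<subseteq> carrier R"
  shows "card (\<Union>z\<in>Z. slice r z) = card Z * card (level r)"
proof -
  have "card (\<Union>z\<in>Z. slice r z) = (\<Sum>z\<in>Z. card (slice r z))"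
  proof (rule card_UN_disjoint)
    show "\<forall>i\<in>Z. \<forall>j\<in>Z. i \<noteq> j \<longrightarrow> slice r i \<inter> slice r j = {}"
      using B_slice assms by blast
  qed (use assms finite_R finite_slice finite_subset in auto)
  also have "\<dots> = card Z * card (level r)"
    using assms by (simp add: card_slice subset_iff)
  finally show ?thesis .
qed

text \<open>Pairing with \<open>v\<close> recovers \<open>z\<close>; pairing with \<open>w\<close>
  then recovers \<open>u\<close>.\<close>

lemma center_inj:
  assumes "z \<in> carrier R" "u \<in> carrier R" "z' \<in> carrier R" "u' \<in> carrier R"
    and eq: "center z u = center z' u'"
  shows "z = z'" "u = u'"
proof -
  have "B (center z u) v = B (center z' u') v" using eq by simp
  then show z: "z = z'" using assms(1-4) by (simp add: center_def form_simps B_w_v B_self Q_v)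
  have "B (center z u) w = B (center z' u') w" using eq by simp
  then show "u = u'" using assms(1-4) z by (simp add: center_def form_simps B_v_w)
qed

lemma Q_diff_center:
  assumes "x \<in> carrier M" "z \<in> carrier R" "u \<in> carrier R"
  shows "Q (x \<ominus>\<^bsub>M\<^esub> center z u) = Q (x \<ominus>\<^bsub>M\<^esub> z \<odot>\<^bsub>M\<^esub> w) \<oplus> u \<otimes> ((z \<ominus> B x v) \<oplus> (z \<ominus> B x v))"
proof -
  have "Q (x \<ominus>\<^bsub>M\<^esub> center z u)
      = Q x \<oplus> (z \<otimes> z \<otimes> Q w \<oplus> (u \<otimes> z \<oplus> u \<otimes> z))
        \<ominus> (z \<otimes> B x w \<oplus> u \<otimes> B x v \<oplus> (z \<otimes> B x w \<oplus> u \<otimes> B x v))"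
    using assms by (simp add: center_def form_simps B_w_v Q_v)
  also have "\<dots> = (Q x \<oplus> z \<otimes> z \<otimes> Q w \<ominus> (z \<otimes> B x w \<oplus> z \<otimes> B x w))
      \<oplus> u \<otimes> ((z \<ominus> B x v) \<oplus> (z \<ominus> B x v))"
    using assms Q_closed[of x] Q_closed[of w] B_closed[of x w] B_closed[of x v] v_closed w_closed
    by algebra
  finally show ?thesis using assms by (simp add: form_simps)
qed

lemma Q_diff_center_slice:
  assumes "z \<in> carrier R" "u \<in> carrier R" "x \<in> carrier M" "B x v = z"
  shows "Q (x \<ominus>\<^bsub>M\<^esub> center z u) = Q (x \<ominus>\<^bsub>M\<^esub> z \<odot>\<^bsub>M\<^esub> w)"
proof -
  have "z \<ominus> B x v = \<zero>" using assms by simp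
  then show ?thesis using assms(1-3) by (simp add: Q_diff_center del: R.r_right_minus_eq)
qed

lemma card_centers_through:
  assumes r: "r \<in> carrier R" and b: "b \<in> carrier R" and z: "z \<in> carrier R" and x: "x \<in> slice r b"
  shows "card {u \<in> carrier R. Q (x \<ominus>\<^bsub>M\<^esub> center z u) = r} = (if b = z then order R else 1)"
proof -
  have xm: "x \<in> carrier M" and Bx: "B x v = b" using x b by (simp_all add: slice_eq)
  have "{u \<in> carrier R. Q (x \<ominus>\<^bsub>M\<^esub> center z u) = r} = carrier R" if "b = z"
    using x z that by (auto simp: Q_diff_center_slice slice_eq)
  moreover have "card {u \<in> carrier R. Q (x \<ominus>\<^bsub>M\<^esub> center z u) = r} = 1" if "b \<noteq> z"
  proof -
    let ?a = "(z \<ominus> b) \<oplus> (z \<ominus> b)" and ?k = "Q (x \<ominus>\<^bsub>M\<^esub> z \<odot>\<^bsub>M\<^esub> w)"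
    have a: "?a \<in> carrier R" "?a \<noteq> \<zero>" using that b z double_nonzero[of "z \<ominus> b"] by auto
    have k: "?k \<in> carrier R" using xm z by simp
    have ia: "inv ?a \<in> carrier R" "?a \<otimes> inv ?a = \<one>" using a field_Units by auto
    have "{u \<in> carrier R. Q (x \<ominus>\<^bsub>M\<^esub> center z u) = r} = {u \<in> carrier R. ?k \<oplus> u \<otimes> ?a = r}"
      using xm z by (auto simp: Q_diff_center Bx)
    also have "\<dots> = {(r \<ominus> ?k) \<otimes> inv ?a}"
      using affine_equation_solution[OF a k r] ia k r by auto
    finally show ?thesis by simp
  qed
  ultimately show ?thesis by (simp add: order_def)
qed

text \<open>With nonzero slope, two different parameters cannot give the same value
  \<open>r\<close>. So membership in both spheres forces slope zero, that is
  \<open>B x v = z\<close>, and there the value does not depend on the parameter.\<close>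

lemma two_spheres_inter:
  assumes r: "r \<in> carrier R" and z: "z \<in> carrier R" and u: "u \<in> carrier R" "u' \<in> carrier R" "u \<noteq> u'"
    and x: "x \<in> carrier M"
  shows "Q (x \<ominus>\<^bsub>M\<^esub> center z u) = r \<and> Q (x \<ominus>\<^bsub>M\<^esub> center z u') = r \<longleftrightarrow> x \<in> slice r z"
proof
  assume "Q (x \<ominus>\<^bsub>M\<^esub> center z u) = r \<and> Q (x \<ominus>\<^bsub>M\<^esub> center z u') = r"
  then have h: "Q (x \<ominus>\<^bsub>M\<^esub> z \<odot>\<^bsub>M\<^esub> w) \<oplus> u \<otimes> ((z \<ominus> B x v) \<oplus> (z \<ominus> B x v)) = r"
    "Q (x \<ominus>\<^bsub>M\<^esub> z \<odot>\<^bsub>M\<^esub> w) \<oplus> u' \<otimes> ((z \<ominus> B x v) \<oplus> (z \<ominus> B x v)) = r"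
    using x z u by (simp_all add: Q_diff_center)
  have k: "Q (x \<ominus>\<^bsub>M\<^esub> z \<odot>\<^bsub>M\<^esub> w) \<in> carrier R" using x z by simp
  have "B x v = z"
  proof (rule ccontr)
    assume "B x v \<noteq> z"
    then have a: "(z \<ominus> B x v) \<oplus> (z \<ominus> B x v) \<in> carrier R" "(z \<ominus> B x v) \<oplus> (z \<ominus> B x v) \<noteq> \<zero>"
      using x z double_nonzero[of "z \<ominus> B x v"] by auto
    show False
      using affine_equation_solution[OF a k r u(1)] affine_equation_solution[OF a k r u(2)] h u(3)
      by simp
  qed
  then show "x \<in> slice r z"
    using \<open>Q (x \<ominus>\<^bsub>M\<^esub> center z u) = r \<and> _\<close> Q_diff_center_slice[OF z u(1) x] x z
    by (simp add: slice_eq)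
next
  assume "x \<in> slice r z"
  then show "Q (x \<ominus>\<^bsub>M\<^esub> center z u) = r \<and> Q (x \<ominus>\<^bsub>M\<^esub> center z u') = r"
    using z u x by (simp add: slice_eq Q_diff_center_slice)
qed

lemma center_diff:
  assumes "z \<in> carrier R" "u \<in> carrier R" "u' \<in> carrier R"
  shows "center z u' \<ominus>\<^bsub>M\<^esub> center z u = (u' \<ominus> u) \<odot>\<^bsub>M\<^esub> v"
proof -
  let ?W = "z \<odot>\<^bsub>M\<^esub> w" and ?U = "u \<odot>\<^bsub>M\<^esub> v" and ?U' = "u' \<odot>\<^bsub>M\<^esub> v"
  have m: "?W \<in> carrier M" "?U \<in> carrier M" "?U' \<in> carrier M" using assms by simp_all
  have "center z u' \<ominus>\<^bsub>M\<^esub> center z u = (?U' \<oplus>\<^bsub>M\<^esub> ?W) \<oplus>\<^bsub>M\<^esub> (\<ominus>\<^bsub>M\<^esub> ?W \<oplus>\<^bsub>M\<^esub> \<ominus>\<^bsub>M\<^esub> ?U)"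
    unfolding center_def a_minus_def M.minus_add[OF m(1,2)] M.a_comm[OF m(1,3)] ..
  also have "\<dots> = ?U' \<oplus>\<^bsub>M\<^esub> \<ominus>\<^bsub>M\<^esub> ?U" using m by (simp add: M.a_assoc M.r_neg2)
  also have "\<dots> = (u' \<ominus> u) \<odot>\<^bsub>M\<^esub> v"
    using assms by (simp add: a_minus_def smult_l_distr smult_l_minus)
  finally show ?thesis .
qed

lemma Q_center:
  "\<lbrakk>z \<in> carrier R; u \<in> carrier R\<rbrakk> \<Longrightarrow> Q (center z u) = z \<otimes> z \<otimes> Q w \<oplus> (u \<otimes> z \<oplus> u \<otimes> z)"
  by (simp add: center_def form_simps B_w_v Q_v)

text \<open>The radii and the term with \<open>Q w\<close> cancel, leaving \<open>2 (u' - u)\<close>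
  times \<open>B x v\<close> on the left and the same nonzero factor times \<open>z\<close> on the
  right.\<close>

lemma radical_equation_iff:
  assumes r: "r \<in> carrier R" and z: "z \<in> carrier R" and u: "u \<in> carrier R" "u' \<in> carrier R" "u \<noteq> u'"
    and x: "x \<in> carrier M"
  shows "(\<one> \<oplus> \<one>) \<otimes> B (center z u' \<ominus>\<^bsub>M\<^esub> center z u) x
      = (r \<ominus> r) \<ominus> Q (center z u) \<oplus> Q (center z u') \<longleftrightarrow> B x v = z"
proof -
  let ?a = "(u' \<ominus> u) \<oplus> (u' \<ominus> u)"
  have a: "?a \<in> carrier R" "?a \<noteq> \<zero>" using u double_nonzero[of "u' \<ominus> u"] by auto
  have "(\<one> \<oplus> \<one>) \<otimes> B (center z u' \<ominus>\<^bsub>M\<^esub> center z u) x = (\<one> \<oplus> \<one>) \<otimes> ((u' \<ominus> u) \<otimes> B x v)"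
    using x z u B_commute[of v x] by (simp add: center_diff B_smult_left)
  also have "\<dots> = ?a \<otimes> B x v"
    using u B_closed[OF x v_closed] by algebra
  finally have l: "(\<one> \<oplus> \<one>) \<otimes> B (center z u' \<ominus>\<^bsub>M\<^esub> center z u) x = ?a \<otimes> B x v" .
  have "(r \<ominus> r) \<ominus> Q (center z u) \<oplus> Q (center z u') = ?a \<otimes> z"
    using u z r Q_closed[OF w_closed] unfolding Q_center[OF z u(1)] Q_center[OF z u(2)] by algebra
  then show ?thesis using l a x z R.m_lcancel[of ?a "B x v" z] by simp
qed

text \<open>The two terms of the maximum are two positions of the hyperplane. If \<open>f\<close> is
  nonzero on \<open>V\<close>, it cuts each slice in a proper section, and the bounds add up over
  \<open>Z\<close>. If \<open>f\<close> vanishes on \<open>V\<close>, it is a multiple of the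
  pairing with \<open>v\<close>; the hyperplane is then parallel to \<open>V\<close> and meets at
  most one slice.\<close>

lemma card_blocks_hyperplane_le:
  assumes d: "d \<ge> 4" and r: "r \<in> carrier R" "r \<noteq> \<zero>" and Z: "Z \<subseteq> carrier R" and c: "c \<in> carrier R"
    and f_closed: "\<And>x. x \<in> carrier M \<Longrightarrow> f x \<in> carrier R"
    and f_add: "\<And>x y. \<lbrakk>x \<in> carrier M; y \<in> carrier M\<rbrakk> \<Longrightarrow> f (x \<oplus>\<^bsub>M\<^esub> y) = f x \<oplus> f y"
    and f_smult: "\<And>s x. \<lbrakk>s \<in> carrier R; x \<in> carrier M\<rbrakk> \<Longrightarrow> f (s \<odot>\<^bsub>M\<^esub> x) = s \<otimes> f x"
    and f_nz: "\<exists>x\<in>carrier M. f x \<noteq> \<zero>"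
  shows "card ((\<Union>z\<in>Z. slice r z) \<inter> {x \<in> carrier M. f x = c})
    \<le> max (card (level r)) (2 * card Z * order R ^ (d - 3))"
proof (cases "\<exists>x\<in>V. f x \<noteq> \<zero>")
  case True
  have "card (slice r z \<inter> {x \<in> carrier M. f x = c}) \<le> 2 * order R ^ (d - 3)" if z: "z \<in> Z" for z
  proof -
    have zR: "z \<in> carrier R" using z Z by blast
    \<comment> \<open>The slice is the level translated by \<open>z w\<close>, which shifts the
      prescribed value of \<open>f\<close>.\<close>
    let ?c = "c \<ominus> z \<otimes> f w"
    have cR: "?c \<in> carrier R" using c zR f_closed by simp
    have "slice r z \<inter> {x \<in> carrier M. f x = c}
        \<subseteq> (\<lambda>y. z \<odot>\<^bsub>M\<^esub> w \<oplus>\<^bsub>M\<^esub> y) ` {y \<in> level r. f y = ?c}"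
    proof
      fix x assume x: "x \<in> slice r z \<inter> {x \<in> carrier M. f x = c}"
      then obtain y where y: "y \<in> level r" "x = z \<odot>\<^bsub>M\<^esub> w \<oplus>\<^bsub>M\<^esub> y" by (auto simp: slice_def)
      have ym: "y \<in> carrier M" using y by (simp add: level_def)
      have "z \<otimes> f w \<oplus> f y = c" using x y ym zR by (simp add: f_add f_smult)
      moreover have "f y = (z \<otimes> f w \<oplus> f y) \<ominus> z \<otimes> f w"
        using f_closed[OF ym] f_closed[OF w_closed] zR by algebra
      ultimately have "f y = ?c" by simp
      then show "x \<in> (\<lambda>y. z \<odot>\<^bsub>M\<^esub> w \<oplus>\<^bsub>M\<^esub> y) ` {y \<in> level r. f y = ?c}" using y by blast
    qed
    then have "card (slice r z \<inter> {x \<in> carrier M. f x = c}) \<le> card {y \<in> level r. f y = ?c}"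
      by (rule surj_card_le[rotated]) (simp add: finite_level)
    also have "\<dots> \<le> 2 * order R ^ (d - 3)"
      by (rule card_level_section_le[OF d r cR _ _ _ True]) (auto simp: f_closed f_add f_smult)
    finally show ?thesis .
  qed
  then have "(\<Sum>z\<in>Z. card (slice r z \<inter> {x \<in> carrier M. f x = c})) \<le> card Z * (2 * order R ^ (d - 3))"
    using sum_bounded_above[of Z _ "2 * order R ^ (d - 3)"] by simp
  moreover have "card (\<Union>z\<in>Z. slice r z \<inter> {x \<in> carrier M. f x = c})
      \<le> (\<Sum>z\<in>Z. card (slice r z \<inter> {x \<in> carrier M. f x = c}))"
    by (rule card_UN_le) (use Z finite_R finite_subset in blast)
  ultimately show ?thesis by (simp add: mult.assoc mult.left_commute le_max_iff_disj)
next
  case False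
  then have f0: "f x = \<zero>" if "x \<in> V" for x using that by blast
  have f_eq: "f x = B x v \<otimes> f w" if x: "x \<in> carrier M" for x
  proof -
    have s: "\<ominus> B x v \<in> carrier R" using x by simp
    have "x \<oplus>\<^bsub>M\<^esub> (\<ominus> B x v) \<odot>\<^bsub>M\<^esub> w \<in> V"
      using x s by (simp add: V_def B_add_left B_smult_left B_w_v R.r_neg del: V_closed)
    then have "f x \<oplus> (\<ominus> B x v) \<otimes> f w = \<zero>"
      using f0 f_add f_smult s x by (metis w_closed smult_closed)
    then show ?thesis using f_closed[OF x] f_closed[OF w_closed] B_closed[OF x v_closed]
      by (metis R.l_minus R.minus_closed R.r_right_minus_eq a_minus_def R.m_closed)
  qed
  then have fw: "f w \<noteq> \<zero>" using f_nz by fastforce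
  let ?I = "(\<Union>z\<in>Z. slice r z) \<inter> {x \<in> carrier M. f x = c}"
  have "card ?I \<le> card (level r)"
  proof (cases "?I = {}")
    case False
    then obtain x z where xz: "z \<in> Z" "x \<in> slice r z" "f x = c" by blast
    have "?I \<subseteq> slice r z"
    proof
      fix x' assume "x' \<in> ?I"
      then obtain z' where x': "z' \<in> Z" "x' \<in> slice r z'" "f x' = c" by blast
      have zz: "z \<in> carrier R" "z' \<in> carrier R" using xz x' Z by auto
      have "z \<otimes> f w = z' \<otimes> f w"
        using f_eq[OF slice_closed[OF zz(1) xz(2)]] f_eq[OF slice_closed[OF zz(2) x'(2)]]
          B_slice[OF zz(1) xz(2)] B_slice[OF zz(2) x'(2)] xz x' by simp
      then have "z = z'" using R.m_rcancel[OF fw f_closed[OF w_closed] zz] by simp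
      then show "x' \<in> slice r z" using x' by simp
    qed
    then have "card ?I \<le> card (slice r z)" by (intro card_mono finite_slice)
    then show ?thesis using xz Z by (simp add: card_slice subset_iff)
  qed simp
  then show ?thesis by simp
qed

end

section \<open>Coordinate spaces\<close>

lemma Vec_simps:
  "carrier (Vec F d) = {..<d} \<rightarrow>\<^sub>E carrier F"
  "\<zero>\<^bsub>Vec F d\<^esub> = (\<lambda>i\<in>{..<d}. \<zero>\<^bsub>F\<^esub>)"
  "x \<oplus>\<^bsub>Vec F d\<^esub> y = (\<lambda>i\<in>{..<d}. x i \<oplus>\<^bsub>F\<^esub> y i)"
  "s \<odot>\<^bsub>Vec F d\<^esub> x = (\<lambda>i\<in>{..<d}. s \<otimes>\<^bsub>F\<^esub> x i)"
  by (simp_all add: Vec_def)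

lemma Vec_mem: "\<lbrakk>x \<in> carrier (Vec F d); i < d\<rbrakk> \<Longrightarrow> x i \<in> carrier F"
  by (auto simp: Vec_simps)

lemma restrict_Vec: "(\<And>i. i < d \<Longrightarrow> f i \<in> carrier F) \<Longrightarrow> (\<lambda>i\<in>{..<d}. f i) \<in> carrier (Vec F d)"
  by (auto simp: Vec_simps)

lemma restrict_lessThan_cong:
  "(\<And>i. i < (d::nat) \<Longrightarrow> f i = g i) \<Longrightarrow> (\<lambda>i\<in>{..<d}. f i) = (\<lambda>i\<in>{..<d}. g i)"
  by (rule restrict_ext) simp

lemma restrict_Vec_id: "x \<in> carrier (Vec F d) \<Longrightarrow> (\<lambda>i\<in>{..<d}. x i) = x"
  by (auto simp: Vec_simps PiE_restrict)

lemma Vec_eqI: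
  assumes "x \<in> carrier (Vec F d)" "y \<in> carrier (Vec F d)" "\<And>i. i < d \<Longrightarrow> x i = y i"
  shows "x = y"
  using assms restrict_lessThan_cong[of d x y] restrict_Vec_id by metis

lemma card_Vec: "finite (carrier F) \<Longrightarrow> card (carrier (Vec F d)) = order F ^ d"
  by (simp add: Vec_simps card_PiE order_def)

text \<open>\<open>Vec\<close> takes a plain \<open>'a ring\<close>, so the field is fixed at this
  type rather than at a record extension.\<close>

locale coordinate_field = field R for R :: "'a ring" (structure)
begin

lemma abelian_group_Vec: "abelian_group (Vec R d)"
proof (rule abelian_groupI)
  fix x y assume "x \<in> carrier (Vec R d)" "y \<in> carrier (Vec R d)"
  note m = Vec_mem[OF this(1)] Vec_mem[OF this(2)]
  show "x \<oplus>\<^bsub>Vec R d\<^esub> y \<in> carrier (Vec R d)"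
    unfolding Vec_simps(3) using m by (intro restrict_Vec) simp
  show "x \<oplus>\<^bsub>Vec R d\<^esub> y = y \<oplus>\<^bsub>Vec R d\<^esub> x"
    unfolding Vec_simps(3) using m by (intro restrict_lessThan_cong a_comm)
next
  fix x y z
  assume "x \<in> carrier (Vec R d)" "y \<in> carrier (Vec R d)" "z \<in> carrier (Vec R d)"
  note m = Vec_mem[OF this(1)] Vec_mem[OF this(2)] Vec_mem[OF this(3)]
  show "x \<oplus>\<^bsub>Vec R d\<^esub> y \<oplus>\<^bsub>Vec R d\<^esub> z = x \<oplus>\<^bsub>Vec R d\<^esub> (y \<oplus>\<^bsub>Vec R d\<^esub> z)"
    unfolding Vec_simps(3) using m by (intro restrict_lessThan_cong) (simp add: a_assoc)
next
  fix x assume x: "x \<in> carrier (Vec R d)"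
  note m = Vec_mem[OF x]
  show "\<zero>\<^bsub>Vec R d\<^esub> \<oplus>\<^bsub>Vec R d\<^esub> x = x"
  proof -
    have "\<zero>\<^bsub>Vec R d\<^esub> \<oplus>\<^bsub>Vec R d\<^esub> x = (\<lambda>i\<in>{..<d}. x i)"
      unfolding Vec_simps(2,3) using m by (intro restrict_lessThan_cong) simp
    then show ?thesis using x by (simp add: restrict_Vec_id)
  qed
  have "(\<lambda>i\<in>{..<d}. \<ominus> x i) \<oplus>\<^bsub>Vec R d\<^esub> x = \<zero>\<^bsub>Vec R d\<^esub>"
    unfolding Vec_simps(2,3) using m by (intro restrict_lessThan_cong) (simp add: l_neg)
  moreover have "(\<lambda>i\<in>{..<d}. \<ominus> x i) \<in> carrier (Vec R d)"
    using m by (intro restrict_Vec) simp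
  ultimately show "\<exists>y\<in>carrier (Vec R d). y \<oplus>\<^bsub>Vec R d\<^esub> x = \<zero>\<^bsub>Vec R d\<^esub>" by blast
next
  show "\<zero>\<^bsub>Vec R d\<^esub> \<in> carrier (Vec R d)" unfolding Vec_simps(2) by (intro restrict_Vec) simp
qed

lemma module_Vec: "module R (Vec R d)"
proof (rule moduleI[OF is_cring abelian_group_Vec])
  fix a x assume a: "a \<in> carrier R" and "x \<in> carrier (Vec R d)"
  note m = Vec_mem[OF this(2)]
  show "a \<odot>\<^bsub>Vec R d\<^esub> x \<in> carrier (Vec R d)"
    unfolding Vec_simps(4) using a m by (intro restrict_Vec) simp
next
  fix a b x assume a: "a \<in> carrier R" "b \<in> carrier R" and "x \<in> carrier (Vec R d)"
  note m = Vec_mem[OF this(3)]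
  show "(a \<oplus> b) \<odot>\<^bsub>Vec R d\<^esub> x = a \<odot>\<^bsub>Vec R d\<^esub> x \<oplus>\<^bsub>Vec R d\<^esub> b \<odot>\<^bsub>Vec R d\<^esub> x"
    unfolding Vec_simps(3,4) using a m by (intro restrict_lessThan_cong) (simp add: l_distr)
  show "a \<otimes> b \<odot>\<^bsub>Vec R d\<^esub> x = a \<odot>\<^bsub>Vec R d\<^esub> (b \<odot>\<^bsub>Vec R d\<^esub> x)"
    unfolding Vec_simps(4) using a m by (intro restrict_lessThan_cong) (simp add: m_assoc)
next
  fix a x y assume a: "a \<in> carrier R" and "x \<in> carrier (Vec R d)" "y \<in> carrier (Vec R d)"
  note m = Vec_mem[OF this(2)] Vec_mem[OF this(3)]
  show "a \<odot>\<^bsub>Vec R d\<^esub> (x \<oplus>\<^bsub>Vec R d\<^esub> y) = a \<odot>\<^bsub>Vec R d\<^esub> x \<oplus>\<^bsub>Vec R d\<^esub> a \<odot>\<^bsub>Vec R d\<^esub> y"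
    unfolding Vec_simps(3,4) using a m by (intro restrict_lessThan_cong) (simp add: r_distr)
next
  fix x assume x: "x \<in> carrier (Vec R d)"
  have "\<one> \<odot>\<^bsub>Vec R d\<^esub> x = (\<lambda>i\<in>{..<d}. x i)"
    unfolding Vec_simps(4) using Vec_mem[OF x] by (intro restrict_lessThan_cong) simp
  then show "\<one> \<odot>\<^bsub>Vec R d\<^esub> x = x" using x by (simp add: restrict_Vec_id)
qed

section \<open>Dot products and bilinear forms in coordinates\<close>

definition dot :: "nat \<Rightarrow> (nat \<Rightarrow> 'a) \<Rightarrow> (nat \<Rightarrow> 'a) \<Rightarrow> 'a" where
  "dot d a x = (\<Oplus>i\<in>{..<d}. a i \<otimes> x i)"

lemma dot_closed:
  "\<lbrakk>a \<in> {..<d} \<rightarrow> carrier R; x \<in> carrier (Vec R d)\<rbrakk> \<Longrightarrow> dot d a x \<in> carrier R"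
  using Vec_mem[of x R d] by (auto simp: dot_def intro!: finsum_closed)

lemma dot_add:
  assumes a: "a \<in> {..<d} \<rightarrow> carrier R" and x: "x \<in> carrier (Vec R d)" and y: "y \<in> carrier (Vec R d)"
  shows "dot d a (x \<oplus>\<^bsub>Vec R d\<^esub> y) = dot d a x \<oplus> dot d a y"
proof -
  have m: "a i \<in> carrier R" "x i \<in> carrier R" "y i \<in> carrier R" if "i \<in> {..<d}" for i
    using a Vec_mem[OF x] Vec_mem[OF y] that by auto
  have "dot d a (x \<oplus>\<^bsub>Vec R d\<^esub> y) = (\<Oplus>i\<in>{..<d}. a i \<otimes> x i \<oplus> a i \<otimes> y i)"
    unfolding dot_def Vec_simps(3) using m by (intro finsum_cong') (auto simp: r_distr)
  also have "\<dots> = dot d a x \<oplus> dot d a y"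
    unfolding dot_def using m by (intro finsum_addf) auto
  finally show ?thesis .
qed

lemma dot_smult:
  assumes a: "a \<in> {..<d} \<rightarrow> carrier R" and s: "s \<in> carrier R" and x: "x \<in> carrier (Vec R d)"
  shows "dot d a (s \<odot>\<^bsub>Vec R d\<^esub> x) = s \<otimes> dot d a x"
proof -
  have m: "a i \<in> carrier R" "x i \<in> carrier R" if "i \<in> {..<d}" for i
    using a Vec_mem[OF x] that by auto
  have "dot d a (s \<odot>\<^bsub>Vec R d\<^esub> x) = (\<Oplus>i\<in>{..<d}. s \<otimes> (a i \<otimes> x i))"
    unfolding dot_def Vec_simps(4) using m s by (intro finsum_cong') (auto simp: m_lcomm)
  also have "\<dots> = s \<otimes> dot d a x"
    unfolding dot_def using m s by (intro finsum_rdistr[symmetric]) auto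
  finally show ?thesis .
qed

lemma dot_commute:
  assumes x: "x \<in> carrier (Vec R d)" and y: "y \<in> carrier (Vec R d)"
  shows "dot d x y = dot d y x"
  unfolding dot_def using Vec_mem[OF x] Vec_mem[OF y] by (intro finsum_cong') (auto intro: m_comm)

lemma dot_single:
  assumes "a \<in> {..<d} \<rightarrow> carrier R" "k < d"
  shows "dot d a (\<lambda>i\<in>{..<d}. if k = i then \<one> else \<zero>) = a k"
proof -
  have "dot d a (\<lambda>i\<in>{..<d}. if k = i then \<one> else \<zero>) = (\<Oplus>i\<in>{..<d}. if k = i then a i else \<zero>)"
    unfolding dot_def using assms by (intro finsum_cong') (auto simp: Pi_iff)
  also have "\<dots> = a k" using assms by (intro finsum_singleton) auto
  finally show ?thesis .
qed

lemma dot_nonzero: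
  assumes "a \<in> carrier (Vec R d)" "a \<noteq> \<zero>\<^bsub>Vec R d\<^esub>"
  shows "\<exists>x\<in>carrier (Vec R d). dot d a x \<noteq> \<zero>"
proof -
  obtain k where k: "k < d" "a k \<noteq> \<zero>"
    using assms Vec_eqI[of a R d "\<zero>\<^bsub>Vec R d\<^esub>"] by (fastforce simp: Vec_simps)
  have "dot d a (\<lambda>i\<in>{..<d}. if k = i then \<one> else \<zero>) = a k"
    using assms k by (intro dot_single) (auto simp: Vec_simps)
  moreover have "(\<lambda>i\<in>{..<d}. if k = i then \<one> else \<zero>) \<in> carrier (Vec R d)"
    by (auto simp: Vec_simps)
  ultimately show ?thesis using k by metis
qed

text \<open>The matrix-vector product. It is itself an element of \<open>Vec R d\<close>, which lets
  \<open>bilin\<close> inherit linearity in both arguments from \<open>dot\<close>.\<close>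

definition row :: "nat \<Rightarrow> (nat \<Rightarrow> nat \<Rightarrow> 'a) \<Rightarrow> (nat \<Rightarrow> 'a) \<Rightarrow> nat \<Rightarrow> 'a" where
  "row d a x = (\<lambda>i\<in>{..<d}. dot d (a i) x)"

definition bilin :: "nat \<Rightarrow> (nat \<Rightarrow> nat \<Rightarrow> 'a) \<Rightarrow> (nat \<Rightarrow> 'a) \<Rightarrow> (nat \<Rightarrow> 'a) \<Rightarrow> 'a" where
  "bilin d a x y = dot d x (row d a y)"

context
  fixes d :: nat and a :: "nat \<Rightarrow> nat \<Rightarrow> 'a"
  assumes a: "a \<in> {..<d} \<rightarrow> {..<d} \<rightarrow> carrier R"
begin

lemma a_row: "i < d \<Longrightarrow> a i \<in> {..<d} \<rightarrow> carrier R"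
  using a by auto

lemma Vec_Pi: "x \<in> carrier (Vec R d) \<Longrightarrow> x \<in> {..<d} \<rightarrow> carrier R"
  by (auto simp: Vec_simps)

lemma row_closed: "x \<in> carrier (Vec R d) \<Longrightarrow> row d a x \<in> carrier (Vec R d)"
  using dot_closed[OF a_row] by (auto simp: row_def Vec_simps)

lemma row_add:
  "\<lbrakk>x \<in> carrier (Vec R d); y \<in> carrier (Vec R d)\<rbrakk>
    \<Longrightarrow> row d a (x \<oplus>\<^bsub>Vec R d\<^esub> y) = row d a x \<oplus>\<^bsub>Vec R d\<^esub> row d a y"
  unfolding Vec_simps(3)[of R d "row d a x"]
  by (auto simp: row_def dot_add[OF a_row] intro!: restrict_ext)

lemma row_smult:
  "\<lbrakk>s \<in> carrier R; x \<in> carrier (Vec R d)\<rbrakk>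
    \<Longrightarrow> row d a (s \<odot>\<^bsub>Vec R d\<^esub> x) = s \<odot>\<^bsub>Vec R d\<^esub> row d a x"
  unfolding Vec_simps(4)[of R d s "row d a x"]
  by (auto simp: row_def dot_smult[OF a_row] intro!: restrict_ext)

lemma bilin_closed:
  "\<lbrakk>x \<in> carrier (Vec R d); y \<in> carrier (Vec R d)\<rbrakk> \<Longrightarrow> bilin d a x y \<in> carrier R"
  unfolding bilin_def by (intro dot_closed Vec_Pi row_closed)

lemma bilin_add_right:
  "\<lbrakk>x \<in> carrier (Vec R d); y \<in> carrier (Vec R d); z \<in> carrier (Vec R d)\<rbrakk>
    \<Longrightarrow> bilin d a x (y \<oplus>\<^bsub>Vec R d\<^esub> z) = bilin d a x y \<oplus> bilin d a x z"
  by (simp add: bilin_def row_add dot_add Vec_Pi row_closed)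

lemma bilin_smult_right:
  "\<lbrakk>s \<in> carrier R; x \<in> carrier (Vec R d); y \<in> carrier (Vec R d)\<rbrakk>
    \<Longrightarrow> bilin d a x (s \<odot>\<^bsub>Vec R d\<^esub> y) = s \<otimes> bilin d a x y"
  by (simp add: bilin_def row_smult dot_smult Vec_Pi row_closed)

text \<open>The matrix need not be symmetric, but \<open>dot\<close> is: exchanging its arguments
  turns the left argument of \<open>bilin\<close> into a right argument of
  \<open>dot\<close>.\<close>

lemma bilin_add_left:
  assumes "x \<in> carrier (Vec R d)" "y \<in> carrier (Vec R d)" "z \<in> carrier (Vec R d)"
  shows "bilin d a (y \<oplus>\<^bsub>Vec R d\<^esub> z) x = bilin d a y x \<oplus> bilin d a z x"
proof -
  interpret V: abelian_group "Vec R d" by (rule abelian_group_Vec)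
  have "bilin d a (y \<oplus>\<^bsub>Vec R d\<^esub> z) x = dot d (row d a x) (y \<oplus>\<^bsub>Vec R d\<^esub> z)"
    unfolding bilin_def by (rule dot_commute) (use assms row_closed in simp_all)
  also have "\<dots> = dot d (row d a x) y \<oplus> dot d (row d a x) z"
    using assms by (simp add: dot_add Vec_Pi row_closed)
  finally show ?thesis
    using assms by (simp add: bilin_def dot_commute[of _ d "row d a x"] row_closed)
qed

lemma bilin_smult_left:
  assumes "s \<in> carrier R" "x \<in> carrier (Vec R d)" "y \<in> carrier (Vec R d)"
  shows "bilin d a (s \<odot>\<^bsub>Vec R d\<^esub> y) x = s \<otimes> bilin d a y x"
proof -
  interpret V: module R "Vec R d" by (rule module_Vec)
  have "bilin d a (s \<odot>\<^bsub>Vec R d\<^esub> y) x = dot d (row d a x) (s \<odot>\<^bsub>Vec R d\<^esub> y)"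
    unfolding bilin_def by (rule dot_commute) (use assms row_closed in simp_all)
  also have "\<dots> = s \<otimes> dot d (row d a x) y"
    using assms by (simp add: dot_smult Vec_Pi row_closed)
  finally show ?thesis
    using assms by (simp add: bilin_def dot_commute[of _ d "row d a x"] row_closed)
qed

lemma bilin_eq_double_sum:
  assumes x: "x \<in> carrier (Vec R d)"
  shows "bilin d a x x = (\<Oplus>i\<in>{..<d}. \<Oplus>j\<in>{..<d}. a i j \<otimes> x i \<otimes> x j)"
  unfolding bilin_def dot_def[of d x]
proof (rule finsum_cong'[OF refl])
  have xi: "x i \<in> carrier R" if "i < d" for i using x that by (auto simp: Vec_simps)
  have aij: "a i j \<in> carrier R" if "i < d" "j < d" for i j using a that by auto
  show "(\<lambda>i. \<Oplus>j\<in>{..<d}. a i j \<otimes> x i \<otimes> x j) \<in> {..<d} \<rightarrow> carrier R"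
    using xi aij by (auto intro!: finsum_closed)
  fix i assume "i \<in> {..<d}"
  then have i: "i < d" by simp
  have "x i \<otimes> row d a x i = (\<Oplus>j\<in>{..<d}. x i \<otimes> (a i j \<otimes> x j))"
    unfolding row_def dot_def using i xi aij by (simp add: finsum_rdistr)
  also have "\<dots> = (\<Oplus>j\<in>{..<d}. a i j \<otimes> x i \<otimes> x j)"
    using i xi aij by (intro finsum_cong') (auto simp: m_ac)
  finally show "x i \<otimes> row d a x i = (\<Oplus>j\<in>{..<d}. a i j \<otimes> x i \<otimes> x j)" .
qed

end

end

text \<open>A coefficient matrix \<open>a\<close> gives \<open>Q x = bilin d a x x\<close>, and
  \<open>bform\<close> is the symmetrization of \<open>bilin d a\<close> multiplied by one half. The
  axioms then follow from bilinearity.\<close>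

lemma (in coordinate_field) finite_quadratic_space_Vec:
  assumes fin: "finite (carrier R)" and odd: "odd (order R)"
    and form: "quadratic_form R d Q" and nd: "nondegenerate R d Q"
  shows "finite_quadratic_space R (Vec R d) d Q (bform R d Q)"
proof -
  interpret V: module R "Vec R d" by (rule module_Vec)
  obtain a where a: "a \<in> {..<d} \<rightarrow> {..<d} \<rightarrow> carrier R"
    and Qa: "\<And>x. x \<in> carrier (Vec R d)
      \<Longrightarrow> Q x = (\<Oplus>i\<in>{..<d}. \<Oplus>j\<in>{..<d}. a i j \<otimes> x i \<otimes> x j)"
    using form unfolding quadratic_form_def by blast
  note bl = bilin_closed[OF a] bilin_add_right[OF a] bilin_smult_right[OF a]
    bilin_add_left[OF a] bilin_smult_left[OF a]
  have Q: "Q x = bilin d a x x" if "x \<in> carrier (Vec R d)" for x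
    using Qa bilin_eq_double_sum[OF a] that by simp
  define h where "h = inv (two R)"
  have two: "two R \<in> carrier R" "two R \<noteq> \<zero>"
    using double_nonzero[OF fin odd, of \<one>] by (auto simp: two_def)
  then have h: "h \<in> carrier R" "(\<one> \<oplus> \<one>) \<otimes> h = \<one>"
    using field_Units by (auto simp: h_def simp flip: two_def)
  have B: "bform R d Q x y = (bilin d a x y \<oplus> bilin d a y x) \<otimes> h"
    if xy: "x \<in> carrier (Vec R d)" "y \<in> carrier (Vec R d)" for x y
  proof -
    have "Q (x \<oplus>\<^bsub>Vec R d\<^esub> y)
        = bilin d a x x \<oplus> bilin d a y x \<oplus> (bilin d a x y \<oplus> bilin d a y y)"
      using xy by (simp add: Q bl)
    then have "Q (x \<oplus>\<^bsub>Vec R d\<^esub> y) \<ominus> Q x \<ominus> Q y = bilin d a x y \<oplus> bilin d a y x"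
      using bl(1)[OF xy] bl(1)[OF xy(2,1)] bl(1)[OF xy(1,1)] bl(1)[OF xy(2,2)]
      unfolding Q[OF xy(1)] Q[OF xy(2)] by (simp, algebra)
    then show ?thesis by (simp add: bform_def h_def)
  qed
  show ?thesis
  proof unfold_locales
    show "finite (carrier R)" "odd (order R)" by fact+
    show "card (carrier (Vec R d)) = order R ^ d" by (rule card_Vec[OF fin])
    fix x y assume xy: "x \<in> carrier (Vec R d)" "y \<in> carrier (Vec R d)"
    show "bform R d Q x y \<in> carrier R" using xy h by (simp add: B bl)
    show "bform R d Q x y = bform R d Q y x" using xy h by (simp add: B bl a_comm)
    show "Q x \<in> carrier R" using xy by (simp add: Q bl)
    show "Q (x \<oplus>\<^bsub>Vec R d\<^esub> y) = Q x \<oplus> Q y \<oplus> (bform R d Q x y \<oplus> bform R d Q x y)"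
    proof -
      have "bform R d Q x y \<oplus> bform R d Q x y
          = (bilin d a x y \<oplus> bilin d a y x) \<otimes> ((\<one> \<oplus> \<one>) \<otimes> h)"
        unfolding B[OF xy] using bl(1)[OF xy] bl(1)[OF xy(2,1)] h(1) by algebra
      then have "bform R d Q x y \<oplus> bform R d Q x y = bilin d a x y \<oplus> bilin d a y x"
        using h xy bl(1) by simp
      moreover have "Q (x \<oplus>\<^bsub>Vec R d\<^esub> y)
          = bilin d a x x \<oplus> bilin d a y x \<oplus> (bilin d a x y \<oplus> bilin d a y y)"
        using xy by (simp add: Q bl)
      ultimately show ?thesis
        unfolding Q[OF xy(1)] Q[OF xy(2)]
        using bl(1)[OF xy] bl(1)[OF xy(2,1)] bl(1)[OF xy(1,1)] bl(1)[OF xy(2,2)]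
        by (simp add: a_ac)
    qed
    fix s assume s: "s \<in> carrier R"
    show "Q (s \<odot>\<^bsub>Vec R d\<^esub> x) = s \<otimes> s \<otimes> Q x" using xy s by (simp add: Q bl m_assoc)
    show "bform R d Q (s \<odot>\<^bsub>Vec R d\<^esub> x) y = s \<otimes> bform R d Q x y"
    proof -
      have "bform R d Q (s \<odot>\<^bsub>Vec R d\<^esub> x) y = (s \<otimes> bilin d a x y \<oplus> s \<otimes> bilin d a y x) \<otimes> h"
        using xy s by (simp add: B bl)
      also have "\<dots> = s \<otimes> ((bilin d a x y \<oplus> bilin d a y x) \<otimes> h)"
        using bl(1)[OF xy] bl(1)[OF xy(2,1)] s h(1) by algebra
      finally show ?thesis by (simp add: B[OF xy])
    qed
  next
    fix x y z
    assume xyz: "x \<in> carrier (Vec R d)" "y \<in> carrier (Vec R d)" "z \<in> carrier (Vec R d)"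
    show "bform R d Q (x \<oplus>\<^bsub>Vec R d\<^esub> y) z = bform R d Q x z \<oplus> bform R d Q y z"
    proof -
      have "bform R d Q (x \<oplus>\<^bsub>Vec R d\<^esub> y) z
          = ((bilin d a x z \<oplus> bilin d a y z) \<oplus> (bilin d a z x \<oplus> bilin d a z y)) \<otimes> h"
        using xyz by (simp add: B bl)
      also have "\<dots> = (bilin d a x z \<oplus> bilin d a z x) \<otimes> h \<oplus> (bilin d a y z \<oplus> bilin d a z y) \<otimes> h"
        using bl(1)[OF xyz(1,3)] bl(1)[OF xyz(3,1)] bl(1)[OF xyz(2,3)] bl(1)[OF xyz(3,2)] h(1)
        by algebra
      finally show ?thesis using xyz by (simp add: B)
    qed
  next
    fix x assume "x \<in> carrier (Vec R d)"
      and "\<And>y. y \<in> carrier (Vec R d) \<Longrightarrow> bform R d Q x y = \<zero>"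
    then show "x = \<zero>\<^bsub>Vec R d\<^esub>" using nd unfolding nondegenerate_def by blast
  qed
qed

section \<open>The block construction\<close>

lemma isotropic_frame_Vec:
  assumes "quadratic_space F d Q" "isotropic_pair F d Q v w"
  shows "isotropic_frame F (Vec F d) d Q (bform F d Q) v w"
proof -
  interpret F: coordinate_field F
    using assms by (auto simp: quadratic_space_def coordinate_field_def)
  interpret finite_quadratic_space F "Vec F d" d Q "bform F d Q"
    using assms by (intro F.finite_quadratic_space_Vec) (auto simp: quadratic_space_def)
  show ?thesis
    by unfold_locales (use assms in \<open>auto simp: quadratic_space_def isotropic_pair_def\<close>)
qed

text \<open>Incidences are counted by points because the degrees are constant on the sets of
  interest.\<close>

lemma card_incidences:
  assumes "finite A" "finite T"
  shows "card {(p, S). p \<in> A \<and> S \<in> T \<and> p \<in> sphere_pts F d Q S} = (\<Sum>p\<in>A. deg_at F d Q T p)"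
proof -
  have "{(p, S). p \<in> A \<and> S \<in> T \<and> p \<in> sphere_pts F d Q S}
      = Sigma A (\<lambda>p. {S \<in> T. p \<in> sphere_pts F d Q S})" by auto
  then show ?thesis using assms by (simp add: deg_at_def)
qed

locale block_construction =
  fixes F :: "'a ring" and d Q v w R Z
  assumes block: "block_data F d Q v w R Z"
begin

sublocale isotropic_frame F "Vec F d" d Q "bform F d Q" v w
  by (rule isotropic_frame_Vec) (use block in \<open>simp_all add: block_data_def\<close>)

lemma R_props: "R \<in> carrier F" "R \<noteq> \<zero>\<^bsub>F\<^esub>"
  using block by (auto simp: block_data_def admissible_radius_def)

lemma Z_subset: "Z \<subseteq> carrier F"
  using block by (simp add: block_data_def)

lemma Z_carrier: "z \<in> Z \<Longrightarrow> z \<in> carrier F"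
  using Z_subset by blast

lemma finite_Z: "finite Z"
  using Z_subset finite_R finite_subset by blast

lemma card_Z_pos: "card Z > 0"
  using block finite_Z by (simp add: block_data_def card_gt_0_iff)

lemma perp_eq: "perp F d Q v = V"
  unfolding perp_def V_def ..

lemma block_X_eq: "block_X F d Q v R = level R"
  by (simp add: block_X_def level_def perp_eq)

lemma card_level_pos: "card (level R) > 0"
proof -
  obtain y where "y \<in> perp F d Q v" "Q y = R"
    using block unfolding block_data_def admissible_radius_def by blast
  then have "y \<in> level R" by (simp add: level_def perp_eq)
  then show ?thesis using finite_level card_gt_0_iff by blast
qed

lemma block_A_eq: "block_A F d Q v w R z = slice R z"
  by (simp add: block_A_def block_center_def slice_def block_X_eq)

lemma block_sphere_eq: "block_sphere F d v w R z u = (center z u, R)"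
  by (simp add: block_sphere_def block_center_def center_def)

lemma all_P_eq: "all_P F d Q v w R Z = (\<Union>z\<in>Z. slice R z)"
  by (simp add: all_P_def block_A_eq)

lemma card_all_P: "card (all_P F d Q v w R Z) = card Z * card (level R)"
  by (simp add: all_P_eq card_Union_slice Z_subset)

lemma block_S_eq: "block_S F d v w R z = (\<lambda>u. (center z u, R)) ` carrier F"
  by (simp add: block_S_def block_sphere_eq)

lemma block_S_inj: "z \<in> carrier F \<Longrightarrow> inj_on (\<lambda>u. (center z u, R)) (carrier F)"
  by (auto intro!: inj_onI dest: center_inj(2))

lemma finite_block_S: "finite (block_S F d v w R z)"
  by (simp add: block_S_eq finite_R)

lemma card_block_S: "z \<in> carrier F \<Longrightarrow> card (block_S F d v w R z) = order F"
  by (simp add: block_S_eq card_image[OF block_S_inj] order_def)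

lemma block_S_disjoint:
  "\<lbrakk>z \<in> Z; z' \<in> Z; z \<noteq> z'\<rbrakk> \<Longrightarrow> block_S F d v w R z \<inter> block_S F d v w R z' = {}"
  by (auto simp: block_S_eq dest: center_inj(1) Z_carrier)

lemma finite_all_S: "finite (all_S F d v w R Z)"
  by (simp add: all_S_def finite_Z finite_block_S)

lemma card_all_S: "card (all_S F d v w R Z) = card Z * order F"
proof -
  have "card (all_S F d v w R Z) = (\<Sum>z\<in>Z. card (block_S F d v w R z))"
    unfolding all_S_def
    by (rule card_UN_disjoint) (auto simp: finite_Z finite_block_S block_S_disjoint)
  then show ?thesis by (simp add: card_block_S Z_carrier)
qed

lemma sphere_pts_eq: "sphere_pts F d Q (c, r) = {x \<in> carrier (Vec F d). Q (x \<ominus>\<^bsub>Vec F d\<^esub> c) = r}"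
  by (simp add: sphere_pts_def)

section \<open>Degrees, incidence excess and the exact parameter\<close>

lemma deg_at_block:
  assumes b: "b \<in> carrier F" and z: "z \<in> carrier F" and x: "x \<in> slice R b"
  shows "deg_at F d Q (block_S F d v w R z) x = (if b = z then order F else 1)"
proof -
  have xm: "x \<in> carrier (Vec F d)" using slice_closed[OF b x] .
  have "{S \<in> block_S F d v w R z. x \<in> sphere_pts F d Q S}
      = (\<lambda>u. (center z u, R)) ` {u \<in> carrier F. Q (x \<ominus>\<^bsub>Vec F d\<^esub> center z u) = R}"
    using xm by (auto simp: block_S_eq sphere_pts_eq)
  then have "deg_at F d Q (block_S F d v w R z) x
      = card {u \<in> carrier F. Q (x \<ominus>\<^bsub>Vec F d\<^esub> center z u) = R}"
    unfolding deg_at_def using card_image[OF inj_on_subset[OF block_S_inj[OF z]]] by simp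
  then show ?thesis using card_centers_through[OF R_props(1) b z x] by simp
qed

text \<open>A point lies on all \<open>q\<close> spheres of its own block and on one sphere of each
  of the other \<open>t - 1\<close> blocks.\<close>

lemma deg_at_all_S:
  assumes x: "x \<in> all_P F d Q v w R Z"
  shows "deg_at F d Q (all_S F d v w R Z) x = order F + card Z - 1"
proof -
  obtain b where b: "b \<in> Z" "x \<in> slice R b" using x by (auto simp: all_P_eq)
  have "{S \<in> all_S F d v w R Z. x \<in> sphere_pts F d Q S}
      = (\<Union>z\<in>Z. {S \<in> block_S F d v w R z. x \<in> sphere_pts F d Q S})"
    by (auto simp: all_S_def)
  moreover have "card (\<Union>z\<in>Z. {S \<in> block_S F d v w R z. x \<in> sphere_pts F d Q S})
      = (\<Sum>z\<in>Z. card {S \<in> block_S F d v w R z. x \<in> sphere_pts F d Q S})"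
    by (rule card_UN_disjoint) (use block_S_disjoint in \<open>auto simp: finite_Z finite_block_S\<close>)
  ultimately have "deg_at F d Q (all_S F d v w R Z) x
      = (\<Sum>z\<in>Z. deg_at F d Q (block_S F d v w R z) x)"
    by (simp add: deg_at_def)
  also have "\<dots> = (\<Sum>z\<in>Z. if b = z then order F else 1)"
    using b Z_carrier by (intro sum.cong) (simp_all add: deg_at_block)
  also have "\<dots> = order F + (\<Sum>z\<in>Z - {b}. if b = z then order F else 1)"
    using b finite_Z by (subst sum.remove[of Z b]) simp_all
  also have "(\<Sum>z\<in>Z - {b}. if b = z then order F else 1) = (\<Sum>z\<in>Z - {b}. 1)"
    by (rule sum.cong) auto
  \<comment> \<open>The subtraction on natural numbers is exact because \<open>Z\<close> is
    nonempty.\<close>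
  also have "order F + (\<Sum>z\<in>Z - {b}. 1) = order F + card Z - 1"
    using b finite_Z card_Z_pos by simp
  finally show ?thesis .
qed

text \<open>A block has \<open>q\<close> spheres, so the expected number of incidences with any
  slice is exactly its size \<open>N\<close>; the actual number is \<open>q N\<close> on the
  diagonal and \<open>N\<close> off it.\<close>

lemma sigma_block:
  assumes b: "b \<in> Z" and z: "z \<in> Z"
  shows "sigma_inc F d Q (block_A F d Q v w R b) (block_S F d v w R z)
    = (if b = z then (real (order F) - 1) * real (card (level R)) else 0)"
proof -
  have "(\<Sum>p\<in>slice R b. deg_at F d Q (block_S F d v w R z) p)
      = card (level R) * (if b = z then order F else 1)"
    using deg_at_block[OF Z_carrier[OF b] Z_carrier[OF z]]
    by (simp add: card_slice Z_carrier[OF b])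
  then show ?thesis
    using order_gt_1
    by (simp add: sigma_inc_def block_A_eq card_incidences finite_slice finite_block_S card_slice
        card_block_S Z_carrier b z algebra_simps)
qed

text \<open>The count \<open>t N (q + t - 1)\<close> exceeds the expected \<open>t^2 N\<close> by
  \<open>t N (q - 1)\<close>.\<close>

lemma sigma_all:
  "sigma_inc F d Q (all_P F d Q v w R Z) (all_S F d v w R Z)
    = real (card Z) * (real (order F) - 1) * real (card (level R))"
proof -
  have fin: "finite (all_P F d Q v w R Z)" by (simp add: all_P_eq finite_Z finite_slice)
  have "(\<Sum>p\<in>all_P F d Q v w R Z. deg_at F d Q (all_S F d v w R Z) p)
      = card Z * card (level R) * (order F + card Z - 1)"
    by (simp add: deg_at_all_S card_all_P)
  then have "sigma_inc F d Q (all_P F d Q v w R Z) (all_S F d v w R Z)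
      = real (card Z * card (level R) * (order F + card Z - 1))
        - real (card Z * card (level R)) * real (card Z * order F) / real (order F)"
    by (simp add: sigma_inc_def card_incidences fin finite_all_S card_all_P card_all_S)
  also have "real (card Z * card (level R) * (order F + card Z - 1))
      = real (card Z * card (level R)) * (real (order F) + real (card Z) - 1)"
    using card_Z_pos by (simp add: of_nat_diff)
  finally show ?thesis using order_gt_1 by (simp add: algebra_simps)
qed

text \<open>The radicand is \<open>t^2 N q\<close>, so \<open>t\<close> cancels. One
  \<open>sqrt q\<close> comes from the radicand and one from splitting the power of
  \<open>q\<close>; together they form the denominator of \<open>(q - 1) / q\<close>.\<close>

lemma K_star_eq:
  "K_star F d Q v w R Z
    = (1 - 1 / real (order F)) * (sqrt (real (card (level R))) / real (order F) powr ((real d - 2) / 2))"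
proof -
  define q t N where "q = real (order F)" and "t = real (card Z)" and "N = real (card (level R))"
  have pos: "q > 1" "t > 0" "N > 0"
    using order_gt_1 card_Z_pos card_level_pos by (simp_all add: q_def t_def N_def)
  have "K_star F d Q v w R Z
      = t * (q - 1) * N / (q powr ((real d - 1) / 2) * sqrt (t * N * (t * q)))"
    by (simp add: K_star_def exact_param_def sigma_all card_all_P card_all_S q_def t_def N_def)
  also have "t * N * (t * q) = t ^ 2 * (N * q)" by (simp add: power2_eq_square)
  also have "sqrt (t ^ 2 * (N * q)) = t * (sqrt N * sqrt q)"
    using pos by (simp add: real_sqrt_mult)
  also have "q powr ((real d - 1) / 2) = q powr ((real d - 2) / 2) * sqrt q"
    using pos by (simp add: powr_half_sqrt[symmetric] powr_add[symmetric] field_simps)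
  also have "t * (q - 1) * N / (q powr ((real d - 2) / 2) * sqrt q * (t * (sqrt N * sqrt q)))
      = (q - 1) * (sqrt N * sqrt N) / (q powr ((real d - 2) / 2) * (sqrt q * sqrt q) * sqrt N)"
    using pos by simp
  also have "\<dots> = (1 - 1 / q) * (sqrt N / q powr ((real d - 2) / 2))"
  proof -
    have cancel: "(q - 1) * (a * a) / (p * q * a) = (1 - 1 / q) * (a / p)" if "a > 0" "p > 0" for a p
      using that pos by (simp add: field_simps)
    have "sqrt q * sqrt q = q" using pos by simp
    then show ?thesis using cancel[of "sqrt N" "q powr ((real d - 2) / 2)"] pos by simp
  qed
  finally show ?thesis by (simp add: q_def N_def)
qed

text \<open>The content is that the denominator of \<open>exact_param\<close> is positive:
  \<open>Z\<close> is nonempty and the radius is attained on \<open>V\<close>.\<close>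

lemma sigma_eq_K_star:
  "sigma_inc F d Q (all_P F d Q v w R Z) (all_S F d v w R Z)
    = K_star F d Q v w R Z * real (order F) powr ((real d - 1) / 2)
      * sqrt (real (card (all_P F d Q v w R Z)) * real (card (all_S F d v w R Z)))"
proof -
  have "real (order F) powr ((real d - 1) / 2) > 0" using order_gt_1 by simp
  moreover have "sqrt (real (card (all_P F d Q v w R Z)) * real (card (all_S F d v w R Z))) > 0"
    using order_gt_1 card_Z_pos card_level_pos by (simp add: card_all_P card_all_S)
  ultimately show ?thesis
    unfolding K_star_def exact_param_def mult.assoc
    by (metis mult_pos_pos less_irrefl nonzero_eq_divide_eq)
qed

section \<open>Pairs of spheres within a block, and hyperplane sections\<close>

lemma spheres_inter:
  assumes "z \<in> Z" "u \<in> carrier F" "u' \<in> carrier F" "u \<noteq> u'"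
  shows "sphere_pts F d Q (block_sphere F d v w R z u)
    \<inter> sphere_pts F d Q (block_sphere F d v w R z u') = block_A F d Q v w R z"
proof (intro equalityI subsetI)
  fix x assume "x \<in> sphere_pts F d Q (block_sphere F d v w R z u)
    \<inter> sphere_pts F d Q (block_sphere F d v w R z u')"
  then show "x \<in> block_A F d Q v w R z"
    using two_spheres_inter[OF R_props(1) Z_carrier[OF assms(1)] assms(2-4)]
    by (auto simp: block_sphere_eq sphere_pts_eq block_A_eq)
next
  fix x assume "x \<in> block_A F d Q v w R z"
  then show "x \<in> sphere_pts F d Q (block_sphere F d v w R z u)
    \<inter> sphere_pts F d Q (block_sphere F d v w R z u')"
    using two_spheres_inter[OF R_props(1) Z_carrier[OF assms(1)] assms(2-4)]
      slice_closed[OF Z_carrier[OF assms(1)]]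
    by (auto simp: block_sphere_eq sphere_pts_eq block_A_eq)
qed

lemma center_direction:
  assumes "z \<in> Z" "u \<in> carrier F" "u' \<in> carrier F" "u \<noteq> u'"
  shows "\<exists>a\<in>carrier F - {\<zero>\<^bsub>F\<^esub>}. fst (block_sphere F d v w R z u')
    \<ominus>\<^bsub>Vec F d\<^esub> fst (block_sphere F d v w R z u) = a \<odot>\<^bsub>Vec F d\<^esub> v"
proof
  show "u' \<ominus>\<^bsub>F\<^esub> u \<in> carrier F - {\<zero>\<^bsub>F\<^esub>}" using assms by auto
  show "fst (block_sphere F d v w R z u') \<ominus>\<^bsub>Vec F d\<^esub> fst (block_sphere F d v w R z u)
      = (u' \<ominus>\<^bsub>F\<^esub> u) \<odot>\<^bsub>Vec F d\<^esub> v"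
    using assms by (simp add: block_sphere_eq center_diff Z_carrier)
qed

lemma radical_hyperplane_eq:
  assumes "z \<in> Z" "u \<in> carrier F" "u' \<in> carrier F" "u \<noteq> u'"
  shows "radical_hyperplane F d Q (block_sphere F d v w R z u) (block_sphere F d v w R z u')
    = {x \<in> carrier (Vec F d). bform F d Q x v = z}"
  unfolding radical_hyperplane_def block_sphere_eq two_def fst_conv snd_conv
  by (rule Collect_cong, rule conj_cong[OF refl],
      rule radical_equation_iff[OF R_props(1) Z_carrier[OF assms(1)] assms(2-4)])

lemma card_hyperplane_le:
  assumes d: "d \<ge> 4" and H: "H \<in> affine_hyperplanes F d"
  shows "card (all_P F d Q v w R Z \<inter> H) \<le> max (card (level R)) (2 * card Z * order F ^ (d - 3))"
proof -
  interpret F: coordinate_field F by unfold_locales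
  obtain a b where a: "a \<in> carrier (Vec F d)" "a \<noteq> \<zero>\<^bsub>Vec F d\<^esub>" and b: "b \<in> carrier F"
    and H': "H = {x \<in> carrier (Vec F d). (\<Oplus>\<^bsub>F\<^esub>i\<in>{..<d}. a i \<otimes>\<^bsub>F\<^esub> x i) = b}"
    using H unfolding affine_hyperplanes_def by blast
  have aPi: "a \<in> {..<d} \<rightarrow> carrier F" using a by (auto simp: Vec_mem)
  show ?thesis
    unfolding all_P_eq H' F.dot_def[symmetric]
    by (rule card_blocks_hyperplane_le[OF d R_props Z_subset b F.dot_closed F.dot_add F.dot_smult
          F.dot_nonzero])
      (use aPi a in simp_all)
qed

section \<open>Quantitative estimates for large fields\<close>

lemma level_ratio_deviation:
  assumes d: "d \<ge> 4"
  shows "\<bar>real (card (level R)) / real (order F) ^ (d - 2) - 1\<bar> \<le> sqrt (2 / real (order F))"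
proof -
  define q N where "q = real (order F)" and "N = real (card (level R))"
  define m where "m = q ^ (d - 2)"
  have q: "q > 1" using order_gt_1 by (simp add: q_def)
  have m: "m > 0" using q by (simp add: m_def)
  have "(N - m) ^ 2 \<le> 2 * (q * m)"
    using card_level_deviation[OF R_props] power_dim(2)[of q] by (simp add: q_def N_def m_def)
  then have "((N - m) / m) ^ 2 \<le> 2 * (q * m) / m ^ 2"
    unfolding power_divide by (rule divide_right_mono) simp
  also have "\<dots> = 2 * q / m" using m by (simp add: power2_eq_square)
  \<comment> \<open>This is where \<open>d \<ge> 4\<close> enters: \<open>m = q ^ (d - 2)\<close> is
    at least \<open>q ^ 2\<close>.\<close>
  also have "\<dots> \<le> 2 * q / q ^ 2"
    using q d by (intro divide_left_mono) (auto simp: m_def intro!: power_increasing)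
  also have "\<dots> = 2 / q" using q by (simp add: power2_eq_square)
  finally have "sqrt (((N - m) / m) ^ 2) \<le> sqrt (2 / q)" by (rule real_sqrt_le_mono)
  moreover have "(N - m) / m = N / m - 1" using m by (simp add: diff_divide_distrib)
  ultimately have "\<bar>N / m - 1\<bar> \<le> sqrt (2 / q)" by (simp only: real_sqrt_abs)
  then show ?thesis by (simp only: q_def N_def m_def)
qed

text \<open>Here \<open>K_star\<close> is \<open>(1 - 1 / q) * s\<close> with \<open>s\<close> the
  square root of the level ratio, and \<open>s \<ge> 0\<close> gives
  \<open>\<bar>s - 1\<bar> \<le> \<bar>s ^ 2 - 1\<bar>\<close>. The resulting bound depends on
  \<open>q\<close> alone.\<close>

lemma K_star_deviation:
  assumes d: "d \<ge> 4"
  shows "\<bar>K_star F d Q v w R Z - 1\<bar>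
    \<le> sqrt (2 / real (order F)) + (1 + sqrt (2 / real (order F))) / real (order F)"
proof -
  define q where "q = real (order F)"
  define s where "s = sqrt (real (card (level R)) / q ^ (d - 2))"
  have q: "q > 1" using order_gt_1 by (simp add: q_def)
  have s0: "s \<ge> 0" using q by (simp add: s_def)
  have "q powr ((real d - 2) / 2) = sqrt (q ^ (d - 2))"
    using q dim_ge_3 by (simp add: powr_half_sqrt[symmetric] powr_powr[symmetric] powr_realpow[symmetric] of_nat_diff powr_powr)
  then have K: "K_star F d Q v w R Z = (1 - 1 / q) * s"
    by (simp add: K_star_eq s_def q_def real_sqrt_divide)
  have "\<bar>s - 1\<bar> * 1 \<le> \<bar>s - 1\<bar> * \<bar>s + 1\<bar>" using s0 by (intro mult_left_mono) auto
  also have "\<dots> = \<bar>s ^ 2 - 1\<bar>" by (simp add: abs_mult[symmetric] power2_eq_square algebra_simps)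
  also have "s ^ 2 = real (card (level R)) / q ^ (d - 2)" using q by (simp add: s_def)
  also have "\<bar>\<dots> - 1\<bar> \<le> sqrt (2 / q)" using level_ratio_deviation[OF d] by (simp add: q_def)
  finally have s1: "\<bar>s - 1\<bar> \<le> sqrt (2 / q)" by simp
  have "\<bar>K_star F d Q v w R Z - 1\<bar> = \<bar>(s - 1) - s / q\<bar>" by (simp add: K algebra_simps)
  also have "\<dots> \<le> \<bar>s - 1\<bar> + s / q" using s0 q abs_triangle_ineq4[of "s - 1" "s / q"] by simp
  also have "\<dots> \<le> sqrt (2 / q) + (1 + sqrt (2 / q)) / q"
    using s1 q by (intro add_mono divide_right_mono) auto
  finally show ?thesis by (simp add: q_def)
qed

lemma finite_affine_hyperplanes: "finite (affine_hyperplanes F d)"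
  by (rule finite_subset[of _ "Pow (carrier (Vec F d))"]) (auto simp: affine_hyperplanes_def finite_M)

lemma affine_hyperplanes_nonempty: "affine_hyperplanes F d \<noteq> {}"
proof -
  have "v \<noteq> \<zero>\<^bsub>Vec F d\<^esub>" using block by (simp add: block_data_def isotropic_pair_def)
  \<comment> \<open>The witness uses \<open>v\<close> as coefficient vector and \<open>R\<close> as
    constant term.\<close>
  then show ?thesis unfolding affine_hyperplanes_def using v_closed R_props(1) by blast
qed

text \<open>With \<open>P\<close> of size \<open>t N\<close>, the first term of the hyperplane bound
  is the fraction \<open>1 / t\<close> of \<open>P\<close>. The second is at most the fraction
  \<open>4 / q\<close>, because \<open>N \<ge> q ^ (d - 2) / 2\<close>.\<close>

lemma concentration_le:
  assumes d: "d \<ge> 4" and q8: "order F \<ge> 8"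
  shows "Max ((\<lambda>H. real (card (all_P F d Q v w R Z \<inter> H)) / real (card (all_P F d Q v w R Z)))
      ` affine_hyperplanes F d) \<le> 4 * max (1 / real (card Z)) (1 / real (order F))"
proof (rule Max.boundedI)
  fix y
  assume "y \<in> (\<lambda>H. real (card (all_P F d Q v w R Z \<inter> H)) / real (card (all_P F d Q v w R Z)))
      ` affine_hyperplanes F d"
  then obtain H where H: "H \<in> affine_hyperplanes F d"
    and y: "y = real (card (all_P F d Q v w R Z \<inter> H)) / real (card (all_P F d Q v w R Z))" by blast
  define q t N where "q = real (order F)" and "t = real (card Z)" and "N = real (card (level R))"
  have pos: "q \<ge> 8" "t > 0" "N > 0"
    using q8 card_Z_pos card_level_pos by (simp_all add: q_def t_def N_def)
  have "\<bar>N / q ^ (d - 2) - 1\<bar> \<le> sqrt (2 / q)"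
    using level_ratio_deviation[OF d] by (simp add: N_def q_def)
  \<comment> \<open>The threshold 8 is what brings \<open>2 / q\<close> down to
    \<open>1 / 4\<close>.\<close>
  also have "\<dots> \<le> sqrt ((1 / 2) ^ 2)" using pos by (intro real_sqrt_le_mono) (simp add: field_simps)
  finally have "\<bar>N / q ^ (d - 2) - 1\<bar> \<le> 1 / 2" by simp
  then have "N / q ^ (d - 2) \<ge> 1 / 2" unfolding abs_le_iff by linarith
  then have N: "q * q ^ (d - 3) \<le> 2 * N"
    using pos unfolding power_dim(3)[of q, symmetric] by (simp add: field_simps)
  have "real (card (all_P F d Q v w R Z \<inter> H)) \<le> max N (2 * t * q ^ (d - 3))"
    using of_nat_mono[OF card_hyperplane_le[OF d H], where 'a = real]
    by (simp add: N_def t_def q_def of_nat_max)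
  also have "\<dots> \<le> 4 * max (1 / t) (1 / q) * (t * N)"
  proof (rule max.boundedI)
    have "N = 1 / t * (t * N)" using pos by simp
    also have "\<dots> \<le> 4 * max (1 / t) (1 / q) * (t * N)"
    proof (rule mult_right_mono)
      have "0 < 1 / t" using pos by simp
      then show "1 / t \<le> 4 * max (1 / t) (1 / q)" using max.cobounded1[of "1 / t" "1 / q"] by linarith
    qed (use pos in simp)
    finally show "N \<le> 4 * max (1 / t) (1 / q) * (t * N)" .
    have "2 * t * q ^ (d - 3) = 2 * t * (q * q ^ (d - 3)) / q" using pos by simp
    also have "\<dots> \<le> 2 * t * (2 * N) / q"
      using pos N by (intro divide_right_mono mult_left_mono) auto
    also have "\<dots> = 4 * (1 / q) * (t * N)" by simp
    also have "\<dots> \<le> 4 * max (1 / t) (1 / q) * (t * N)"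
      using pos by (intro mult_right_mono mult_left_mono) auto
    finally show "2 * t * q ^ (d - 3) \<le> 4 * max (1 / t) (1 / q) * (t * N)" .
  qed
  finally show "y \<le> 4 * max (1 / real (card Z)) (1 / real (order F))"
    using pos by (simp add: y card_all_P q_def t_def N_def pos_divide_le_eq)
qed (simp_all add: finite_affine_hyperplanes affine_hyperplanes_nonempty)

end

text \<open>Any nonzero value \<open>Q y\<close> with \<open>y\<close> in \<open>V\<close> will do
  as radius: its level has \<open>2 q\<close> points, and the exponent \<open>(d - 2) / 2\<close> is
  one half.\<close>

lemma ex_radius_dim_3:
  assumes qs: "quadratic_space F 3 Q" and ip: "isotropic_pair F 3 Q v w"
    and Z: "Z \<subseteq> carrier F" "Z \<noteq> {}"
  shows "\<exists>R. admissible_radius F 3 Q v R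
    \<and> K_star F 3 Q v w R Z = (1 - 1 / real (order F)) * sqrt 2"
proof -
  interpret fr: isotropic_frame F "Vec F 3" 3 Q "bform F 3 Q" v w
    by (rule isotropic_frame_Vec[OF qs ip])
  obtain y where y: "y \<in> fr.V" "Q y \<noteq> \<zero>\<^bsub>F\<^esub>" using fr.ex_anisotropic_V by blast
  have "y \<in> perp F 3 Q v" using y(1) unfolding perp_def fr.V_def .
  then have adm: "admissible_radius F 3 Q v (Q y)"
    using y fr.Q_closed[OF fr.V_closed[OF y(1)]] unfolding admissible_radius_def by blast
  interpret block_construction F 3 Q v w "Q y" Z
    by unfold_locales (use qs ip adm Z in \<open>simp add: block_data_def\<close>)
  have "sqrt (real (2 * order F)) / real (order F) powr ((real 3 - 2) / 2) = sqrt 2"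
  proof -
    have "real (order F) powr ((real 3 - 2) / 2) = sqrt (real (order F))"
      using powr_half_sqrt[of "real (order F)"] by simp
    moreover have "sqrt (real (2 * order F)) = sqrt 2 * sqrt (real (order F))"
      by (simp add: real_sqrt_mult)
    ultimately show ?thesis using fr.order_gt_1 by simp
  qed
  then have "K_star F 3 Q v w (Q y) Z = (1 - 1 / real (order F)) * sqrt 2"
    unfolding K_star_eq fr.card_level_dim_3[OF refl y] by simp
  then show ?thesis using adm by blast
qed

text \<open>The deviation bound involves only \<open>q\<close>, so the limit is uniform over all
  fields of order \<open>q\<close> and all block data.\<close>

lemma eventually_K_star_close:
  assumes d: "d \<ge> 4" and \<epsilon>: "\<epsilon> > 0"
  shows "\<forall>\<^sub>F q in sequentially. \<forall>(F :: 'a ring) Q v w R Z.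
    order F = q \<and> block_data F d Q v w R Z \<longrightarrow> \<bar>K_star F d Q v w R Z - 1\<bar> < \<epsilon>"
proof -
  have "(\<lambda>q::nat. sqrt (2 / real q) + (1 + sqrt (2 / real q)) / real q) \<longlonglongrightarrow> 0"
    by real_asymp
  then have "\<forall>\<^sub>F q in sequentially. sqrt (2 / real q) + (1 + sqrt (2 / real q)) / real q < \<epsilon>"
    using \<epsilon> by (rule order_tendstoD(2))
  then show ?thesis
  proof (rule eventually_mono, intro allI impI)
    fix q :: nat and F :: "'a ring" and Q v w R Z
    assume q: "sqrt (2 / real q) + (1 + sqrt (2 / real q)) / real q < \<epsilon>"
      and blk: "order F = q \<and> block_data F d Q v w R Z"
    interpret block_construction F d Q v w R Z using blk by unfold_locales simp
    show "\<bar>K_star F d Q v w R Z - 1\<bar> < \<epsilon>" using K_star_deviation[OF d] q blk by simp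
  qed
qed

theorem theorem4p1:
  fixes d :: nat
  assumes "d \<ge> 3"
  shows
    "(\<forall>(F :: 'a ring) Q v w R Z. block_data F d Q v w R Z \<longrightarrow>
       (let q = order F; t = card Z; N = card (block_X F d Q v R);
            A = block_A F d Q v w R; \<S> = block_S F d v w R;
            P = all_P F d Q v w R Z; S = all_S F d v w R Z;
            \<sigma> = sigma_inc F d Q; K = K_star F d Q v w R Z
        in
          \<comment> \<open>(1)\<close>
          (card P = t * N \<and> card S = t * q)
          \<comment> \<open>(2), exact identities\<close>
        \<and> (\<forall>b\<in>Z. \<forall>z\<in>Z. \<sigma> (A b) (\<S> z) = (if b = z then (real q - 1) * real N else 0))
        \<and> \<sigma> P S = real t * (real q - 1) * real N
        \<and> \<sigma> P S = (\<Sum>z\<in>Z. \<sigma> (A z) (\<S> z))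
        \<and> \<sigma> P S = K * real q powr ((real d - 1) / 2) * sqrt (real (card P) * real (card S))
        \<and> K = (1 - 1 / real q) * (sqrt (real N) / real q powr ((real d - 2) / 2))
          \<comment> \<open>(3)\<close>
        \<and> (\<forall>x\<in>P. deg_at F d Q S x = q + t - 1)
          \<comment> \<open>(4)\<close>
        \<and> (\<forall>z\<in>Z. \<forall>u\<in>carrier F. \<forall>u'\<in>carrier F. u \<noteq> u' \<longrightarrow>
             (let S\<^sub>1 = block_sphere F d v w R z u; S\<^sub>2 = block_sphere F d v w R z u'
              in sphere_pts F d Q S\<^sub>1 \<inter> sphere_pts F d Q S\<^sub>2 = A z
               \<and> (\<exists>a \<in> carrier F - {\<zero>\<^bsub>F\<^esub>}.
                    fst S\<^sub>2 \<ominus>\<^bsub>Vec F d\<^esub> fst S\<^sub>1 = a \<odot>\<^bsub>Vec F d\<^esub> v)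
               \<and> radical_hyperplane F d Q S\<^sub>1 S\<^sub>2
                   = {x \<in> carrier (Vec F d). bform F d Q x v = z}))
          \<comment> \<open>(5), hyperplane bound\<close>
        \<and> (d \<ge> 4 \<longrightarrow> (\<forall>H \<in> affine_hyperplanes F d.
             card (P \<inter> H) \<le> max N (2 * t * q ^ (d - 3))))))
     \<comment> \<open>(2), asymptotics of the exact parameter for fixed dimension at least 4\<close>
   \<and> (d \<ge> 4 \<longrightarrow>
       (\<forall>\<epsilon>>0. \<forall>\<^sub>F q in sequentially. \<forall>(F :: 'a ring) Q v w R Z.
          order F = q \<and> block_data F d Q v w R Z \<longrightarrow> \<bar>K_star F d Q v w R Z - 1\<bar> < \<epsilon>))
     \<comment> \<open>(2), choice of the radius in dimension 3\<close>
   \<and> (d = 3 \<longrightarrow>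
       (\<forall>(F :: 'a ring) Q v w Z.
          quadratic_space F d Q \<and> isotropic_pair F d Q v w \<and> Z \<subseteq> carrier F \<and> Z \<noteq> {} \<longrightarrow>
          (\<exists>R. admissible_radius F d Q v R
             \<and> K_star F d Q v w R Z = (1 - 1 / real (order F)) * sqrt 2)))
     \<comment> \<open>(5), uniform concentration bound\<close>
   \<and> (d \<ge> 4 \<longrightarrow>
       (\<exists>B>0. \<forall>\<^sub>F q in sequentially. \<forall>(F :: 'a ring) Q v w R Z.
          order F = q \<and> block_data F d Q v w R Z \<longrightarrow>
          (let P = all_P F d Q v w R Z
           in Max ((\<lambda>H. real (card (P \<inter> H)) / real (card P)) ` affine_hyperplanes F d)
                \<le> B * max (1 / real (card Z)) (1 / real q))))"
proof (intro conjI allI impI)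
  fix F :: "'a ring" and Q v w R Z
  assume "block_data F d Q v w R Z"
  then interpret block_construction F d Q v w R Z by unfold_locales
  show "let q = order F; t = card Z; N = card (block_X F d Q v R);
            A = block_A F d Q v w R; \<S> = block_S F d v w R;
            P = all_P F d Q v w R Z; S = all_S F d v w R Z;
            \<sigma> = sigma_inc F d Q; K = K_star F d Q v w R Z
        in
          (card P = t * N \<and> card S = t * q)
        \<and> (\<forall>b\<in>Z. \<forall>z\<in>Z. \<sigma> (A b) (\<S> z) = (if b = z then (real q - 1) * real N else 0))
        \<and> \<sigma> P S = real t * (real q - 1) * real N
        \<and> \<sigma> P S = (\<Sum>z\<in>Z. \<sigma> (A z) (\<S> z))
        \<and> \<sigma> P S = K * real q powr ((real d - 1) / 2) * sqrt (real (card P) * real (card S))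
        \<and> K = (1 - 1 / real q) * (sqrt (real N) / real q powr ((real d - 2) / 2))
        \<and> (\<forall>x\<in>P. deg_at F d Q S x = q + t - 1)
        \<and> (\<forall>z\<in>Z. \<forall>u\<in>carrier F. \<forall>u'\<in>carrier F. u \<noteq> u' \<longrightarrow>
             (let S\<^sub>1 = block_sphere F d v w R z u; S\<^sub>2 = block_sphere F d v w R z u'
              in sphere_pts F d Q S\<^sub>1 \<inter> sphere_pts F d Q S\<^sub>2 = A z
               \<and> (\<exists>a \<in> carrier F - {\<zero>\<^bsub>F\<^esub>}.
                    fst S\<^sub>2 \<ominus>\<^bsub>Vec F d\<^esub> fst S\<^sub>1 = a \<odot>\<^bsub>Vec F d\<^esub> v)
               \<and> radical_hyperplane F d Q S\<^sub>1 S\<^sub>2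
                   = {x \<in> carrier (Vec F d). bform F d Q x v = z}))
        \<and> (d \<ge> 4 \<longrightarrow> (\<forall>H \<in> affine_hyperplanes F d.
             card (P \<inter> H) \<le> max N (2 * t * q ^ (d - 3))))"
    unfolding Let_def block_X_eq
  proof (intro conjI ballI impI)
    show "sigma_inc F d Q (all_P F d Q v w R Z) (all_S F d v w R Z)
        = (\<Sum>z\<in>Z. sigma_inc F d Q (block_A F d Q v w R z) (block_S F d v w R z))"
      unfolding sigma_all by (simp add: sigma_block cong: sum.cong)
  qed (rule card_all_P card_all_S sigma_block sigma_all sigma_eq_K_star K_star_eq deg_at_all_S
      spheres_inter center_direction radical_hyperplane_eq card_hyperplane_le; assumption)+
next
  fix \<epsilon> :: real
  assume "d \<ge> 4" "\<epsilon> > 0"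
  then show "\<forall>\<^sub>F q in sequentially. \<forall>(F :: 'a ring) Q v w R Z.
      order F = q \<and> block_data F d Q v w R Z \<longrightarrow> \<bar>K_star F d Q v w R Z - 1\<bar> < \<epsilon>"
    by (rule eventually_K_star_close)
next
  fix F :: "'a ring" and Q v w Z
  assume d: "d = 3"
    and h: "quadratic_space F d Q \<and> isotropic_pair F d Q v w \<and> Z \<subseteq> carrier F \<and> Z \<noteq> {}"
  show "\<exists>R. admissible_radius F d Q v R
      \<and> K_star F d Q v w R Z = (1 - 1 / real (order F)) * sqrt 2"
    using h unfolding d by (elim conjE) (rule ex_radius_dim_3)
next
  assume d: "d \<ge> 4"
  have "\<forall>\<^sub>F q in sequentially. \<forall>(F :: 'a ring) Q v w R Z.
      order F = q \<and> block_data F d Q v w R Z \<longrightarrow>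
      (let P = all_P F d Q v w R Z
       in Max ((\<lambda>H. real (card (P \<inter> H)) / real (card P)) ` affine_hyperplanes F d)
            \<le> 4 * max (1 / real (card Z)) (1 / real q))"
    \<comment> \<open>The threshold 8 and the constant 4 come from \<open>concentration_le\<close>;
      both are the same for every \<open>d \<ge> 4\<close>.\<close>
    using eventually_ge_at_top[of 8]
  proof (rule eventually_mono, intro allI impI)
    fix q :: nat and F :: "'a ring" and Q v w R Z
    assume q: "q \<ge> 8" and blk: "order F = q \<and> block_data F d Q v w R Z"
    interpret block_construction F d Q v w R Z using blk by unfold_locales simp
    show "let P = all_P F d Q v w R Z
       in Max ((\<lambda>H. real (card (P \<inter> H)) / real (card P)) ` affine_hyperplanes F d)
            \<le> 4 * max (1 / real (card Z)) (1 / real q)"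
      unfolding Let_def by (rule concentration_le[OF d, unfolded conjunct1[OF blk], OF q])
  qed
  then show "\<exists>B>0. \<forall>\<^sub>F q in sequentially. \<forall>(F :: 'a ring) Q v w R Z.
          order F = q \<and> block_data F d Q v w R Z \<longrightarrow>
          (let P = all_P F d Q v w R Z
           in Max ((\<lambda>H. real (card (P \<inter> H)) / real (card P)) ` affine_hyperplanes F d)
                \<le> B * max (1 / real (card Z)) (1 / real q))"
    by (intro exI[of _ 4] conjI) (simp, assumption)
qed

end
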